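(* For every $m,n,r,s\in \mathbb{N}$ we have $$N(m,n,r,s)= \sum \varphi(x_3)\, \varphi(y_3)\, \varphi(z_3)\, \varphi(t_3)\, F(u,v),$$ where the sum is over all 20-tuples $$(x_1,x_2,x_3,x_4,x_5,\,y_1,y_2,y_3,y_4,y_5,\,z_1,z_2,z_3,z_4,z_5,\,t_1,t_2,t_3,t_4,t_5)\in \mathbb{N}^{20}$$ satisfying the following 10 conditions, the last two of which also define $u$ and $v$: (1) $x_1x_2x_3=m$; (2) $x_3x_4x_5=n$; (3) $y_1y_2y_3=\gcd(x_1,x_4)$; (4) $y_3y_4y_5=x_3\operatorname{lcm}(x_1,x_4)$; (5) $z_1z_2z_3=r$; (6) $z_3z_4z_5=s$; (7) $t_1t_2t_3=\gcd(z_1,z_4)$; (8) $t_3t_4t_5=z_3\operatorname{lcm}(z_1,z_4)$; (9) $\gcd(y_2,y_5)=\gcd(t_2,t_5)=:u$; (10) $y_3\operatorname{lcm}(y_2,y_5)= t_3\operatorname{lcm}(t_2,t_5)=:v$.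
   Context: $\mathbb{N}=\{1,2,\ldots\}$. $\mathbb{Z}_n$ denotes the additive group of residue classes modulo $n$. $N(m,n,r,s)$ denotes the total number of subgroups of the group $\mathbb{Z}_m\times\mathbb{Z}_n\times\mathbb{Z}_r\times\mathbb{Z}_s$. $\varphi$ is Euler's totient function. For $u,v\in\mathbb{N}$, $F(u,v)$ denotes the number of automorphisms of the group $\mathbb{Z}_u\times\mathbb{Z}_v$. *)

theory Defs
  imports "HOL-Algebra.Elementary_Groups" "HOL-Algebra.Bij" "HOL-Number_Theory.Totient"
begin

definition num_subgroups :: "nat \<Rightarrow> nat \<Rightarrow> nat \<Rightarrow> nat \<Rightarrow> nat" where
  "num_subgroups m n r s =
     card {H. subgroup H (integer_mod_group m \<times>\<times> integer_mod_group n \<times>\<times>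
                          integer_mod_group r \<times>\<times> integer_mod_group s)}"

(* The elements of auto G are extensional on carrier G, so each automorphism is
   counted exactly once. *)
definition num_automorphisms :: "nat \<Rightarrow> nat \<Rightarrow> nat" where
  "num_automorphisms u v = card (auto (integer_mod_group u \<times>\<times> integer_mod_group v))"

end

theory Submission
  imports Defs "HOL-Algebra.Multiplicative_Group"
begin

text \<open>By Goursat's lemma, the subgroups of \<open>A \<times> B\<close> correspond to the isomorphisms between a
  subquotient of \<open>A\<close> and a subquotient of \<open>B\<close>. This is used on two levels. For
  \<open>A = \<int>\<^sub>m\<close> and \<open>B = \<int>\<^sub>n\<close> the subquotients are cyclic, and a subgroup \<open>K\<close> is given by
  \<open>(x\<^sub>1, \<dots>, x\<^sub>5)\<close> together with one of \<open>\<phi>(x\<^sub>3)\<close> isomorphisms, where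
  \<open>x\<^sub>1, x\<^sub>3, x\<^sub>2\<close> are the successive indices of \<open>0 \<le> K \<inter> \<int>\<^sub>m \<le> \<pi>\<^sub>1(K) \<le> \<int>\<^sub>m\<close> and
  \<open>x\<^sub>4, x\<^sub>3, x\<^sub>5\<close> are those of the analogous chain in \<open>\<int>\<^sub>n\<close>.
  For \<open>A = \<int>\<^sub>m \<times> \<int>\<^sub>n\<close> and \<open>B = \<int>\<^sub>r \<times> \<int>\<^sub>s\<close> the subquotients are generated by two elements,
  hence of the form \<open>\<int>\<^sub>u \<times> \<int>\<^sub>v\<close> with \<open>u\<close> dividing \<open>v\<close>. Such a group is determined by its order
  \<open>u v\<close> and its exponent \<open>v\<close>, and both can be read off the Goursat data: \<open>K\<close> has order
  \<open>x\<^sub>1 x\<^sub>3 x\<^sub>4\<close> and exponent \<open>lcm(x\<^sub>1 x\<^sub>3, x\<^sub>3 x\<^sub>4)\<close>, while the quotient by \<open>K\<close> has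
  order \<open>x\<^sub>2 x\<^sub>3 x\<^sub>5\<close> and exponent \<open>lcm(x\<^sub>2 x\<^sub>3, x\<^sub>3 x\<^sub>5)\<close>.\<close>

section \<open>Isomorphisms, exponent and type of a group\<close>

text \<open>Maps are fixed outside \<open>carrier G\<close>, so that every isomorphism is exactly
  one function and can be counted.\<close>

definition isos :: "('a, 'c) monoid_scheme \<Rightarrow> ('b, 'd) monoid_scheme \<Rightarrow> ('a \<Rightarrow> 'b) set" where
  "isos G H = iso G H \<inter> extensional (carrier G)"

lemma auto_eq_isos: "auto G = isos G G"
  by (auto simp: auto_def isos_def iso_def Bij_def)

lemma finite_isos:
  assumes "finite (carrier G)" "finite (carrier H)"
  shows "finite (isos G H)"
proof (rule finite_subset)
  show "isos G H \<subseteq> carrier G \<rightarrow>\<^sub>E carrier H"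
    by (auto simp: isos_def iso_def hom_def PiE_def)
  show "finite (carrier G \<rightarrow>\<^sub>E carrier H)"
    using assms by (intro finite_PiE) auto
qed

lemma iso_restrict_eq:
  assumes "group G"
  shows "restrict h (carrier G) \<in> iso G H \<longleftrightarrow> h \<in> iso G H"
proof -
  interpret group G by fact
  have "bij_betw (restrict h (carrier G)) (carrier G) (carrier H) \<longleftrightarrow> bij_betw h (carrier G) (carrier H)"
    by (rule bij_betw_cong) auto
  then show ?thesis
    by (auto simp: iso_def hom_def Pi_iff)
qed

text \<open>Composition with fixed isomorphisms \<open>f\<close> from \<open>G'\<close> to
  \<open>G\<close> and \<open>g\<close> from \<open>H\<close> to \<open>H'\<close> is injective,
  since \<open>f\<close> is onto and \<open>g\<close> is injective; restricting to
  \<open>carrier G'\<close> keeps the result extensional. Exchanging the roles turns the inequality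
  into an equality.\<close>

lemma card_isos_le:
  assumes "group G" "group G'" "group H" "group H'"
    and "finite (carrier G')" "finite (carrier H')" "G \<cong> G'" "H \<cong> H'"
  shows "card (isos G H) \<le> card (isos G' H')"
proof -
  obtain f g where f: "f \<in> iso G' G" and g: "g \<in> iso H H'"
    using assms group.iso_sym[of G G'] by (auto simp: is_iso_def)
  let ?F = "\<lambda>h. restrict (g \<circ> (h \<circ> f)) (carrier G')"
  show ?thesis
  proof (rule card_inj_on_le)
    show "finite (isos G' H')" using assms by (intro finite_isos)
    show "?F ` isos G H \<subseteq> isos G' H'"
      using iso_set_trans[OF iso_set_trans[OF f] g] \<open>group G'\<close>
      by (auto simp: isos_def iso_restrict_eq simp del: o_apply)
    show "inj_on ?F (isos G H)"
    proof (rule inj_onI)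
      fix h h' assume h: "h \<in> isos G H" "h' \<in> isos G H" "?F h = ?F h'"
      show "h = h'"
      proof (rule extensionalityI)
        show "h \<in> extensional (carrier G)" "h' \<in> extensional (carrier G)"
          using h by (auto simp: isos_def)
        fix x assume "x \<in> carrier G"
        then obtain y where y: "y \<in> carrier G'" "x = f y"
          using f by (auto simp: iso_iff)
        with h have "g (h x) = g (h' x)"
          by (metis comp_apply restrict_apply')
        moreover have "h x \<in> carrier H" "h' x \<in> carrier H"
          using h \<open>x \<in> carrier G\<close> by (auto simp: isos_def iso_iff)
        ultimately show "h x = h' x"
          using g by (auto simp: iso_iff inj_on_def)
      qed
    qed
  qed
qed

lemma card_isos_cong:
  assumes "group G" "group G'" "group H" "group H'"
    and "finite (carrier G)" "finite (carrier H)" "G \<cong> G'" "H \<cong> H'"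
  shows "card (isos G H) = card (isos G' H')"
  using assms
  by (intro antisym card_isos_le) (auto simp: group.iso_sym iso_finite[symmetric])

lemma card_isos_eq_0: "\<not> G \<cong> H \<Longrightarrow> card (isos G H) = 0"
  by (simp add: isos_def is_iso_def)

text \<open>The exponent of the group. \<open>Lcm\<close> is 0 when no positive exponent exists, so
  the test \<open>gexp_dvd_iff\<close> holds in every group.\<close>

definition gexp :: "('a, 'b) monoid_scheme \<Rightarrow> nat" where
  "gexp G = Lcm (group.ord G ` carrier G)"

lemma (in group) gexp_dvd_iff: "gexp G dvd k \<longleftrightarrow> (\<forall>x\<in>carrier G. x [^] k = \<one>)"
  by (auto simp: gexp_def Lcm_dvd_iff pow_eq_id)

lemma (in group) gexp_eqI:
  assumes "\<And>k. (\<forall>x\<in>carrier G. x [^] k = \<one>) \<longleftrightarrow> e dvd k"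
  shows "gexp G = e"
  using assms gexp_dvd_iff by (meson dvd_antisym dvd_refl)

lemma (in group) gexp_dvd_order: "gexp G dvd order G"
  by (simp add: gexp_dvd_iff pow_order_eq_1)

lemma gexp_iso:
  assumes "group G" "group H" "G \<cong> H"
  shows "gexp G = gexp H"
proof -
  interpret G: group G by fact
  interpret H: group H by fact
  obtain f where f: "f \<in> iso G H" using assms by (auto simp: is_iso_def)
  interpret group_hom G H f by unfold_locales (use f in \<open>auto simp: iso_iff\<close>)
  show ?thesis
  proof (rule G.gexp_eqI)
    fix k :: nat
    have "x [^]\<^bsub>G\<^esub> k = \<one>\<^bsub>G\<^esub> \<longleftrightarrow> f x [^]\<^bsub>H\<^esub> k = \<one>\<^bsub>H\<^esub>" if "x \<in> carrier G" for x
      using f that by (metis G.nat_pow_closed Group.iso_iff hom_nat_pow hom_one inj_onD G.one_closed)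
    moreover have "carrier H = f ` carrier G" using f by (auto simp: iso_iff)
    ultimately show "(\<forall>x\<in>carrier G. x [^]\<^bsub>G\<^esub> k = \<one>\<^bsub>G\<^esub>) \<longleftrightarrow> gexp H dvd k"
      by (simp add: H.gexp_dvd_iff)
  qed
qed

text \<open>Meant for groups Z_a x Z_b with a dividing b: these have order ab and exponent b, so the
  pair is (a, b).\<close>

definition gtype :: "('a, 'b) monoid_scheme \<Rightarrow> nat \<times> nat" where
  "gtype G = (order G div gexp G, gexp G)"

lemma gtype_iso: "group G \<Longrightarrow> group H \<Longrightarrow> G \<cong> H \<Longrightarrow> gtype G = gtype H"
  using iso_same_card[of G H] by (simp add: gtype_def gexp_iso[of G H] order_def)

lemma DirProd_nat_pow:
  "x [^]\<^bsub>G \<times>\<times> H\<^esub> (k::nat) = (fst x [^]\<^bsub>G\<^esub> k, snd x [^]\<^bsub>H\<^esub> k)"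
  by (induction k) (simp_all add: DirProd_def split: prod.splits)

lemma gexp_DirProd:
  assumes "group G" "group H"
  shows "gexp (G \<times>\<times> H) = lcm (gexp G) (gexp H)"
proof -
  interpret G: group G by fact
  interpret H: group H by fact
  interpret GH: group "G \<times>\<times> H" by (intro DirProd_group assms)
  \<comment> \<open>Both carriers are nonempty, so a statement about all pairs splits into one about
    each factor.\<close>
  have "\<one>\<^bsub>G\<^esub> \<in> carrier G" "\<one>\<^bsub>H\<^esub> \<in> carrier H" by auto
  then show ?thesis
    by (intro GH.gexp_eqI) (auto simp: DirProd_nat_pow G.gexp_dvd_iff H.gexp_dvd_iff)
qed

lemma order_DirProd: "order (G \<times>\<times> H) = order G * order H"
  by (simp add: order_def card_cartesian_product)

section \<open>Exponents and types of cyclic groups and residue class groups\<close>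

lemma (in group) cyclic_ord:
  assumes "x \<in> carrier G" "carrier G = range (\<lambda>k::int. x [^] k)"
  shows "ord x = order G"
proof -
  have "generate G {x} = carrier G"
    using assms by (auto simp: generate_pow)
  then show ?thesis using generate_pow_card[OF assms(1)] by (simp add: order_def)
qed

lemma (in group) cyclic_gexp:
  assumes "cyclic_group G"
  shows "gexp G = order G"
proof -
  obtain x where x: "x \<in> carrier G" "carrier G = range (\<lambda>k::int. x [^] k)"
    using assms cyclic_group by auto
  \<comment> \<open>A generator has order \<open>order G\<close>, so the exponent is at least that
    large; Lagrange bounds it from above.\<close>
  have "ord x dvd gexp G"
    using x by (simp add: gexp_dvd_iff[of "gexp G", simplified] flip: pow_eq_id)
  then show ?thesis
    using gexp_dvd_order cyclic_ord[OF x] by (metis dvd_antisym)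
qed

lemma order_integer_mod_group: "n > 0 \<Longrightarrow> order (integer_mod_group n) = n"
  by (simp add: order_def carrier_integer_mod_group)

lemma finite_integer_mod_group: "n > 0 \<Longrightarrow> finite (carrier (integer_mod_group n))"
  by (simp add: carrier_integer_mod_group)

text \<open>Exponents may be reduced modulo \<open>n\<close>, which makes the power map k -> x^k a
  homomorphism on residues.\<close>

lemma int_pow_mod_order:
  assumes "group G" "x \<in> carrier G" "x [^]\<^bsub>G\<^esub> n = \<one>\<^bsub>G\<^esub>"
  shows "x [^]\<^bsub>G\<^esub> (k mod int n) = x [^]\<^bsub>G\<^esub> k"
proof -
  interpret group G by fact
  have "int (ord x) dvd k - k mod int n"
    using assms by (simp add: minus_mod_eq_mult_div pow_eq_id)
  then show ?thesis using assms by (simp add: int_pow_eq)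
qed

lemma cyclic_integer_mod_group: "cyclic_group (integer_mod_group n)"
proof -
  \<comment> \<open>The generator is written \<open>1 mod int n\<close> because the only residue
    modulo 1 is 0.\<close>
  have "carrier (integer_mod_group n) \<subseteq> range (\<lambda>k::int. (k * (1 mod int n)) mod int n)"
    by (auto simp: carrier_integer_mod_group image_iff mod_mult_right_eq intro: exI[of _ "_ :: int"])
       (metis mod_pos_pos_trivial)
  then show ?thesis
    unfolding group.cyclic_group[OF group_integer_mod_group]
    by (intro bexI[of _ "1 mod int n"]) 
       (auto simp: int_pow_integer_mod_group carrier_integer_mod_group)
qed

lemma gexp_integer_mod_group: "n > 0 \<Longrightarrow> gexp (integer_mod_group n) = n"
  by (simp add: group.cyclic_gexp cyclic_integer_mod_group order_integer_mod_group)

lemma gtype_integer_mod_groups: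
  assumes "a dvd b" "b > 0"
  shows "gtype (integer_mod_group a \<times>\<times> integer_mod_group b) = (a, b)"
proof -
  have "a > 0" using assms by (auto intro: Nat.gr0I)
  then show ?thesis using assms
    by (simp add: gtype_def gexp_DirProd order_DirProd gexp_integer_mod_group
        order_integer_mod_group lcm_proj2_if_dvd_nat)
qed

section \<open>Abelian groups generated by two elements\<close>

text \<open>Generation in the commutative normal form; \<open>g\<close> and \<open>h\<close> may
  coincide or be trivial, so cyclic groups are included.\<close>

definition two_generated :: "('a, 'b) monoid_scheme \<Rightarrow> bool" where
  "two_generated G \<longleftrightarrow> (\<exists>g\<in>carrier G. \<exists>h\<in>carrier G.
     \<forall>x\<in>carrier G. \<exists>(i::int) (j::int). x = g [^]\<^bsub>G\<^esub> i \<otimes>\<^bsub>G\<^esub> h [^]\<^bsub>G\<^esub> j)"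

text \<open>Division with remainder: a nonzero subgroup of the integers consists of the multiples of
  its least positive element. It is applied to the sets of exponents whose powers land in a given
  subgroup.\<close>

lemma int_subgroup_principal:
  fixes S :: "int set"
  assumes "0 \<in> S" "\<And>x y. x \<in> S \<Longrightarrow> y \<in> S \<Longrightarrow> x - y \<in> S"
  obtains a where "S = range (\<lambda>k. a * k)"
proof -
  have neg: "- x \<in> S" if "x \<in> S" for x using assms(2)[OF assms(1) that] by simp
  have add: "x + y \<in> S" if "x \<in> S" "y \<in> S" for x y
    using assms(2)[OF that(1) neg[OF that(2)]] by simp
  have multn: "int k * x \<in> S" if "x \<in> S" for x k
    by (induction k) (auto simp: assms(1) that add algebra_simps)
  have mult: "x * k \<in> S" if "x \<in> S" for x k
    using multn[OF that] neg[OF multn[OF that]]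
    by (cases k rule: int_cases2) (auto simp: mult.commute)
  have "Gcd S \<in> S"
  proof (cases "S \<subseteq> {0}")
    case True
    then show ?thesis using assms(1) by (simp add: Gcd_0_iff[THEN iffD2])
  next
    case False
    then obtain x where "x \<in> S" "x \<noteq> 0" by auto
    then have "nat \<bar>x\<bar> > 0 \<and> int (nat \<bar>x\<bar>) \<in> S" using neg by (auto simp: abs_if)
    then have "\<exists>n. n > 0 \<and> int n \<in> S" by blast
    define d where "d = (LEAST n. n > 0 \<and> int n \<in> S)"
    have d: "d > 0" "int d \<in> S" "\<And>n. n > 0 \<Longrightarrow> int n \<in> S \<Longrightarrow> d \<le> n"
      using LeastI_ex[OF \<open>\<exists>n. n > 0 \<and> int n \<in> S\<close>]
      unfolding d_def by (auto intro: Least_le)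
    \<comment> \<open>The remainder of \<open>y\<close> modulo \<open>d\<close> lies in
      \<open>S\<close> and is below \<open>d\<close>, so by minimality it is 0.\<close>
    have "int d dvd y" if "y \<in> S" for y
    proof -
      have "y mod int d = y - int d * (y div int d)" by (simp add: minus_mult_div_eq_mod)
      then have "int (nat (y mod int d)) \<in> S"
        using assms(2)[OF that mult[OF d(2)], of "y div int d"] d(1)
        by (metis nat_0_le of_nat_0_less_iff pos_mod_sign)
      moreover have "nat (y mod int d) < d" using d(1) by (simp add: nat_less_iff)
      ultimately have "nat (y mod int d) = 0" using d(3) by (meson gr_zeroI leD)
      then have "y mod int d = 0" using d(1) pos_mod_sign[of "int d" y] by linarith
      then show ?thesis by (rule mod_0_imp_dvd)
    qed
    then have "Gcd S = int d"
      using d(2) by (intro Gcd_eqI) auto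
    with d show ?thesis by simp
  qed
  then have "S = range (\<lambda>k. Gcd S * k)"
    using mult by (auto simp: image_iff) (metis Gcd_dvd dvdE)
  then show thesis by (rule that)
qed

lemma two_generated_image:
  assumes "two_generated G" "group G" "group H" "f \<in> hom G H" "f ` carrier G = carrier H"
  shows "two_generated H"
proof -
  interpret group_hom G H f using assms by (simp add: group_hom_def group_hom_axioms_def)
  obtain g h where gh: "g \<in> carrier G" "h \<in> carrier G"
    and gen: "\<And>x. x \<in> carrier G \<Longrightarrow> \<exists>(i::int) (j::int). x = g [^]\<^bsub>G\<^esub> i \<otimes>\<^bsub>G\<^esub> h [^]\<^bsub>G\<^esub> j"
    using assms(1) unfolding two_generated_def by metis
  show ?thesis
    unfolding two_generated_def
  proof (intro bexI ballI)
    fix y assume "y \<in> carrier H"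
    then obtain x where "x \<in> carrier G" "y = f x" using assms(5) by auto
    moreover obtain i j :: int where "x = g [^]\<^bsub>G\<^esub> i \<otimes>\<^bsub>G\<^esub> h [^]\<^bsub>G\<^esub> j"
      using gen \<open>x \<in> carrier G\<close> by blast
    ultimately have "y = f g [^]\<^bsub>H\<^esub> i \<otimes>\<^bsub>H\<^esub> f h [^]\<^bsub>H\<^esub> j"
      using gh by (simp add: hom_int_pow)
    then show "\<exists>(i::int) (j::int). y = f g [^]\<^bsub>H\<^esub> i \<otimes>\<^bsub>H\<^esub> f h [^]\<^bsub>H\<^esub> j"
      by blast
  qed (use gh in auto)
qed

text \<open>The exponents of \<open>g\<close> occurring in \<open>K\<close> are the multiples of
  some \<open>a\<close>, and the exponents of the powers of \<open>h\<close> in \<open>K\<close> are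
  the multiples of some \<open>b\<close>. One member of \<open>K\<close> with first exponent
  \<open>a\<close>, together with \<open>h [^] b\<close>, generates \<open>K\<close>.\<close>

lemma two_generated_subgroup:
  fixes G (structure)
  assumes "two_generated G" "comm_group G" "subgroup K G"
  shows "two_generated (G\<lparr>carrier := K\<rparr>)"
proof -
  interpret comm_group G by fact
  interpret K: subgroup K G by fact
  obtain g h where gh [simp]: "g \<in> carrier G" "h \<in> carrier G"
    and gen: "\<And>x. x \<in> carrier G \<Longrightarrow> \<exists>(i::int) (j::int). x = g [^] i \<otimes> h [^] j"
    using assms(1) unfolding two_generated_def by metis
  have div: "(g [^] i \<otimes> h [^] j) \<otimes> inv (g [^] i' \<otimes> h [^] j') = g [^] (i - i') \<otimes> h [^] (j - j')" for i j i' j' :: int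
    by (simp add: int_pow_diff inv_mult m_ac)
  have Kdiv: "x \<otimes> inv y \<in> K" if "x \<in> K" "y \<in> K" for x y using that by auto
  let ?I = "{i::int. \<exists>j::int. g [^] i \<otimes> h [^] j \<in> K}"
  let ?J = "{j::int. h [^] j \<in> K}"
  obtain a where a: "?I = range (\<lambda>k. a * k)"
  proof (rule int_subgroup_principal)
    have "g [^] (0::int) \<otimes> h [^] (0::int) \<in> K" by simp
    then show "0 \<in> ?I" by blast
    show "x - y \<in> ?I" if "x \<in> ?I" "y \<in> ?I" for x y
      using that Kdiv div by (smt (verit) mem_Collect_eq)
  qed
  obtain b where b: "?J = range (\<lambda>k. b * k)"
  proof (rule int_subgroup_principal)
    show "0 \<in> ?J" by simp
    show "x - y \<in> ?J" if "x \<in> ?J" "y \<in> ?J" for x y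
      using that Kdiv by (auto simp: int_pow_diff)
  qed
  have "a * 1 \<in> ?I" unfolding a by blast
  then obtain j0 :: int where j0: "g [^] a \<otimes> h [^] j0 \<in> K" by auto
  have "b * 1 \<in> ?J" unfolding b by blast
  then have hb: "h [^] b \<in> K" by simp
  show ?thesis
    unfolding two_generated_def
  proof (intro bexI ballI)
    fix x assume "x \<in> carrier (G\<lparr>carrier := K\<rparr>)"
    then have x: "x \<in> K" by simp
    obtain i j :: int where ij: "x = g [^] i \<otimes> h [^] j"
      using gen[OF K.mem_carrier[OF x]] by blast
    with x have "i \<in> ?I" by auto
    then obtain s where s: "i = a * s" unfolding a by auto
    have k1s: "(g [^] a \<otimes> h [^] j0) [^] s = g [^] i \<otimes> h [^] (j0 * s)"
      by (simp add: int_pow_distrib int_pow_pow s)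
    \<comment> \<open>Dividing \<open>x\<close> by this power cancels the part in \<open>g\<close>
      and leaves a power of \<open>h\<close> in \<open>K\<close>.\<close>
    have "(g [^] a \<otimes> h [^] j0) [^] s \<in> K"
      using j0 by (simp add: subgroup_int_pow_closed[OF assms(3)])
    from Kdiv[OF x this] have "j - j0 * s \<in> ?J"
      unfolding k1s by (simp add: ij div)
    then obtain t where t: "j - j0 * s = b * t" unfolding b by auto
    have "h [^] j = h [^] (j0 * s + b * t)" using t by (simp add: algebra_simps)
    then have "x = (g [^] a \<otimes> h [^] j0) [^] s \<otimes> (h [^] b) [^] t"
      unfolding k1s by (simp add: ij int_pow_mult int_pow_pow m_assoc)
    then show "\<exists>(i::int) (k::int). x = (g [^] a \<otimes> h [^] j0) [^]\<^bsub>G\<lparr>carrier := K\<rparr>\<^esub> i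
        \<otimes>\<^bsub>G\<lparr>carrier := K\<rparr>\<^esub> (h [^] b) [^]\<^bsub>G\<lparr>carrier := K\<rparr>\<^esub> k"
      using int_pow_consistent[OF assms(3) j0] int_pow_consistent[OF assms(3) hb] by auto
  qed (use j0 hb in auto)
qed

lemma two_generated_DirProd:
  assumes "cyclic_group G" "cyclic_group H" "group G" "group H"
  shows "two_generated (G \<times>\<times> H)"
proof -
  interpret G: group G by fact
  interpret H: group H by fact
  interpret GH: group "G \<times>\<times> H" by (intro DirProd_group assms)
  obtain g where g: "g \<in> carrier G" "carrier G = range (\<lambda>k::int. g [^]\<^bsub>G\<^esub> k)"
    using assms by (auto simp: G.cyclic_group)
  obtain h where h: "h \<in> carrier H" "carrier H = range (\<lambda>k::int. h [^]\<^bsub>H\<^esub> k)"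
    using assms by (auto simp: H.cyclic_group)
  have f: "fst \<in> hom (G \<times>\<times> H) G" and s: "snd \<in> hom (G \<times>\<times> H) H"
    by (auto simp: hom_def)
  \<comment> \<open>Integer powers are componentwise because both projections are
    homomorphisms.\<close>
  have pow: "x [^]\<^bsub>G \<times>\<times> H\<^esub> k = (fst x [^]\<^bsub>G\<^esub> k, snd x [^]\<^bsub>H\<^esub> k)" if "x \<in> carrier (G \<times>\<times> H)" for x and k :: int
    using hom_int_pow[OF f that GH.is_group G.is_group, of k] hom_int_pow[OF s that GH.is_group H.is_group, of k]
    by (simp add: prod_eq_iff)
  show ?thesis
    unfolding two_generated_def
  proof (intro bexI ballI)
    have *: "(g, \<one>\<^bsub>H\<^esub>) \<in> carrier (G \<times>\<times> H)" "(\<one>\<^bsub>G\<^esub>, h) \<in> carrier (G \<times>\<times> H)" using g h by auto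
    show "\<exists>(i::int) (j::int). x = (g, \<one>\<^bsub>H\<^esub>) [^]\<^bsub>G \<times>\<times> H\<^esub> i \<otimes>\<^bsub>G \<times>\<times> H\<^esub> (\<one>\<^bsub>G\<^esub>, h) [^]\<^bsub>G \<times>\<times> H\<^esub> j"
      if x: "x \<in> carrier (G \<times>\<times> H)" for x
      using x g h by (auto simp: pow[OF *(1)] pow[OF *(2)])
    show "(\<one>\<^bsub>G\<^esub>, h) \<in> carrier (G \<times>\<times> H)" "(g, \<one>\<^bsub>H\<^esub>) \<in> carrier (G \<times>\<times> H)" using * by blast+
  qed
qed

text \<open>Among all pairs of generators choose one whose first member has minimal order \<open>a\<close>.
  A relation with exponents \<open>(i, j)\<close> of gcd \<open>d\<close> yields, by a unimodular change of generators, a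
  pair whose first member has order at most \<open>d\<close>; so \<open>a \<le> d\<close> for every nontrivial relation.\<close>
theorem two_generated_structure:
  fixes G (structure)
  assumes "two_generated G" "comm_group G" "finite (carrier G)"
  obtains a b where "a dvd b" "b > 0" "G \<cong> integer_mod_group a \<times>\<times> integer_mod_group b"
proof -
  interpret comm_group G by fact
  define gens where "gens g h \<longleftrightarrow> g \<in> carrier G \<and> h \<in> carrier G \<and>
    (\<forall>x\<in>carrier G. \<exists>(i::int) (j::int). x = g [^] i \<otimes> h [^] j)" for g h
  have "\<exists>n. \<exists>g h. gens g h \<and> ord g = n"
    using assms(1) by (auto simp: gens_def two_generated_def)
  define a where "a = (LEAST n. \<exists>g h. gens g h \<and> ord g = n)"
  obtain g h where gh: "gens g h" "ord g = a"
    using LeastI_ex[OF \<open>\<exists>n. \<exists>g h. gens g h \<and> ord g = n\<close>] unfolding a_def by auto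
  have a_le: "a \<le> ord g'" if "gens g' h'" for g' h'
    unfolding a_def using that by (auto intro: Least_le)
  have [simp]: "g \<in> carrier G" "h \<in> carrier G" using gh by (auto simp: gens_def)
  have apos: "a > 0" using ord_ge_1[OF assms(3), of g] gh by simp
  have bpos: "ord h > 0" using ord_ge_1[OF assms(3), of h] by simp
  have rel: "int a \<le> gcd i j" if ij: "g [^] i \<otimes> h [^] j = \<one>" "gcd i j > 0" for i j :: int
  proof -
    define d where "d = gcd i j"
    obtain i' j' where i': "i = i' * d" and j': "j = j' * d"
      unfolding d_def by (metis gcd_dvd1 gcd_dvd2 dvd_div_mult_self)
    obtain p q where "p * i + q * j = d" unfolding d_def using bezout_int by blast
    then have "d * (p * i' + q * j') = d * 1" by (simp add: i' j' algebra_simps)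
    then have pq: "p * i' + q * j' = 1" using ij(2) unfolding d_def[symmetric] by simp
    \<comment> \<open>The exponent matrix with rows \<open>(i', j')\<close> and
      \<open>(- q, p)\<close> has determinant \<open>p * i' + q * j' = 1\<close>, so the new pair
      generates as well; the given relation says that \<open>?y1 [^] d\<close> is trivial.\<close>
    let ?y1 = "g [^] i' \<otimes> h [^] j'" and ?y2 = "g [^] (- q) \<otimes> h [^] p"
    have "?y1 [^] d = \<one>" using ij by (simp add: int_pow_distrib int_pow_pow i' j')
    then have "int (ord ?y1) dvd d" by (simp add: int_pow_eq_id)
    then have "int (ord ?y1) \<le> d" using ij d_def by (simp add: zdvd_imp_le)
    moreover have "gens ?y1 ?y2"
      unfolding gens_def
    proof (intro conjI ballI)
      fix x assume "x \<in> carrier G"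
      then obtain k l :: int where x: "x = g [^] k \<otimes> h [^] l" using gh by (auto simp: gens_def)
      have comb: "?y1 [^] s \<otimes> ?y2 [^] t = g [^] (i' * s - q * t) \<otimes> h [^] (j' * s + p * t)" for s t :: int
      proof -
        have "g [^] (i' * s - q * t) = g [^] (i' * s) \<otimes> g [^] (- q * t)"
          by (metis \<open>g \<in> carrier G\<close> diff_conv_add_uminus int_pow_mult mult_minus_left)
        then show ?thesis by (simp add: int_pow_distrib int_pow_pow int_pow_mult m_ac)
      qed
      \<comment> \<open>The exponents of the new generators come from applying the inverse matrix to
        \<open>(k, l)\<close>.\<close>
      have "i' * (p * k + q * l) - q * (i' * l - j' * k) = (p * i' + q * j') * k"
        "j' * (p * k + q * l) + p * (i' * l - j' * k) = (p * i' + q * j') * l"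
        by (simp_all add: algebra_simps)
      then have "?y1 [^] (p * k + q * l) \<otimes> ?y2 [^] (i' * l - j' * k) = x"
        unfolding comb x pq by simp
      then show "\<exists>(s::int) (t::int). x = ?y1 [^] s \<otimes> ?y2 [^] t" by metis
    qed auto
    ultimately show ?thesis using a_le[of ?y1 ?y2] by (simp add: d_def)
  qed
  have ga: "g [^] int a = \<one>" and hb: "h [^] int (ord h) = \<one>"
    by (simp_all add: int_pow_eq_id gh)
  \<comment> \<open>Reducing \<open>i\<close> modulo \<open>a\<close> preserves the relation. A
    nonzero remainder would be smaller than \<open>a\<close> and would bound the gcd, against
    \<open>rel\<close>.\<close>
  have dvd_i: "int a dvd i" if "g [^] i \<otimes> h [^] j = \<one>" for i j :: int
  proof (rule ccontr)
    assume n: "\<not> int a dvd i"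
    have pos: "0 < i mod int a"
      using n apos pos_mod_sign[of "int a" i] by (metis mod_0_imp_dvd of_nat_0_less_iff order_less_le)
    have "g [^] (i mod int a) = g [^] i"
      using ga by (intro int_pow_mod_order) (auto simp: int_pow_int)
    then have "int a \<le> gcd (i mod int a) j"
      using that pos by (intro rel) (auto simp: gcd_pos_int)
    also have "\<dots> \<le> i mod int a"
      using pos by (rule gcd_le1_int)
    also have "\<dots> < int a" using apos by simp
    finally show False by simp
  qed
  have "a dvd ord h"
  proof -
    \<comment> \<open>The relation used here has exponents \<open>a\<close> and
      \<open>ord h\<close>, each power being trivial by itself.\<close>
    have "int a \<le> gcd (int a) (int (ord h))"
      using ga hb apos by (intro rel) (auto simp: gcd_pos_int)
    moreover have "gcd (int a) (int (ord h)) \<le> int a"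
      using apos by (intro gcd_le1_int) simp
    ultimately have "gcd (int a) (int (ord h)) = int a" by simp
    then show ?thesis by (metis gcd_dvd2 int_dvd_int_iff)
  qed
  moreover have "G \<cong> integer_mod_group a \<times>\<times> integer_mod_group (ord h)"
  proof -
    let ?Z = "integer_mod_group a \<times>\<times> integer_mod_group (ord h)"
    interpret Z: group ?Z by (intro DirProd_group) auto
    let ?f = "\<lambda>(i, j). g [^] (i::int) \<otimes> h [^] (j::int)"
    have carr: "carrier ?Z = {0..<int a} \<times> {0..<int (ord h)}"
      using apos bpos by (simp add: carrier_integer_mod_group)
    have gm: "g [^] (i mod int a) = g [^] i" and hm: "h [^] (i mod int (ord h)) = h [^] i" for i
      using ga hb by (auto intro!: int_pow_mod_order simp: int_pow_int)
    have "?f \<in> hom ?Z G"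
      by (auto simp: hom_def gm hm int_pow_mult m_ac)
    then interpret f: group_hom ?Z G ?f by unfold_locales
    have "?f \<in> iso ?Z G"
      unfolding f.iso_iff
    proof (intro conjI subsetI ballI impI)
      fix x assume "x \<in> carrier G"
      then obtain k l :: int where "x = g [^] k \<otimes> h [^] l" using gh by (auto simp: gens_def)
      then have "x = ?f (k mod int a, l mod int (ord h))" by (simp add: gm hm)
      then show "x \<in> ?f ` carrier ?Z"
        using apos bpos by (intro image_eqI[of _ _ "(k mod int a, l mod int (ord h))"])
            (auto simp: carrier_integer_mod_group)
    next
      fix x assume x: "x \<in> carrier ?Z" "?f x = \<one>"
      obtain i j where ij: "x = (i, j)" by fastforce
      \<comment> \<open>Both coordinates are residues below the respective modulus, so divisibility
        makes them vanish: first \<open>i\<close> by \<open>dvd_i\<close>, then \<open>j\<close> by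
        the order of \<open>h\<close>.\<close>
      have "int a dvd i" using x by (intro dvd_i[of i j]) (simp add: ij)
      moreover have "0 \<le> i" "i < int a" "0 \<le> j" "j < int (ord h)"
        using x(1) unfolding carr ij by auto
      ultimately have "i = 0" by (metis zdvd_not_zless order_less_le)
      with x have "h [^] j = \<one>" by (simp add: ij)
      then have "int (ord h) dvd j" by (simp add: int_pow_eq_id)
      with \<open>0 \<le> j\<close> \<open>j < int (ord h)\<close> have "j = 0" by (metis zdvd_not_zless order_less_le)
      with \<open>i = 0\<close> show "x = \<one>\<^bsub>?Z\<^esub>" by (simp add: ij)
    qed
    then show ?thesis using Z.iso_sym is_isoI by blast
  qed
  ultimately show thesis using that bpos by blast
qed

text \<open>The structure theorem yields some pair of factors; since \<open>gtype\<close> is an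
  isomorphism invariant, that pair has to be \<open>gtype G\<close>.\<close>

lemma two_generated_gtype:
  assumes "two_generated G" "comm_group G" "finite (carrier G)" "gtype G = (a, b)"
  shows "a dvd b" "b > 0" "G \<cong> integer_mod_group a \<times>\<times> integer_mod_group b"
proof -
  obtain a' b' where *: "a' dvd b'" "b' > 0" "G \<cong> integer_mod_group a' \<times>\<times> integer_mod_group b'"
    using two_generated_structure[OF assms(1-3)] .
  have "gtype G = (a', b')"
    using gtype_iso[OF _ _ *(3)] gtype_integer_mod_groups[OF *(1,2)] assms(2)
    by (simp add: comm_group_def DirProd_group)
  with * assms(4) show "a dvd b" "b > 0" "G \<cong> integer_mod_group a \<times>\<times> integer_mod_group b" by auto
qed

text \<open>Groups of equal type are isomorphic to the same Z_a x Z_b, to whose automorphisms the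
  isomorphisms are transported. Groups of different types are not isomorphic.\<close>

lemma card_isos_two_generated:
  assumes G: "two_generated G" "comm_group G" "finite (carrier G)"
    and H: "two_generated H" "comm_group H" "finite (carrier H)"
  shows "card (isos G H) =
    (if gtype G = gtype H then num_automorphisms (fst (gtype G)) (snd (gtype G)) else 0)"
proof (cases "gtype G = gtype H")
  case True
  obtain a b where ab: "gtype G = (a, b)" by fastforce
  let ?Z = "integer_mod_group a \<times>\<times> integer_mod_group b"
  have "card (isos G H) = card (isos ?Z ?Z)"
    using two_generated_gtype[OF G ab] two_generated_gtype[OF H] ab True G H
    by (intro card_isos_cong) (auto simp: comm_group_def DirProd_group)
  then show ?thesis by (simp add: True[symmetric] ab num_automorphisms_def auto_eq_isos)
next
  case False
  then have "\<not> G \<cong> H" using gtype_iso G H by (auto simp: comm_group_def)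
  then show ?thesis using False by (simp add: card_isos_eq_0)
qed

section \<open>Goursat's lemma\<close>

text \<open>Turns equality of images into membership in the kernel. The map \<open>p\<close> is a
  homomorphism on the subgroup only, while product and inverse are written in the ambient group,
  where they agree.\<close>

lemma hom_eq_iff_kernel:
  fixes A (structure)
  assumes "group A" "subgroup G A" "group Q" "p \<in> hom (A\<lparr>carrier := G\<rparr>) Q" "x \<in> G" "y \<in> G"
  shows "p x = p y \<longleftrightarrow> p (x \<otimes> inv y) = \<one>\<^bsub>Q\<^esub>"
proof -
  interpret A: group A by fact
  interpret Q: group Q by fact
  interpret G: group "A\<lparr>carrier := G\<rparr>" by (intro A.subgroup_imp_group assms)
  interpret p: group_hom "A\<lparr>carrier := G\<rparr>" Q p by unfold_locales (fact assms)
  have y': "inv y \<in> G" "inv y = inv\<^bsub>A\<lparr>carrier := G\<rparr>\<^esub> y"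
    by (rule subgroup.m_inv_closed[OF assms(2,6)]) (rule A.m_inv_consistent[OF assms(2,6), symmetric])
  have "p (x \<otimes> inv y) = p x \<otimes>\<^bsub>Q\<^esub> p (inv y)"
    using p.hom_mult[of x "inv y"] assms(5) y'(1) by simp
  also have "p (inv y) = inv\<^bsub>Q\<^esub> p y"
    unfolding y'(2) using p.hom_inv[of y] assms(6) by simp
  finally have eq: "p (x \<otimes> inv y) = p x \<otimes>\<^bsub>Q\<^esub> inv\<^bsub>Q\<^esub> p y" .
  have "p x \<in> carrier Q" "p y \<in> carrier Q"
    using p.hom_closed[of x] p.hom_closed[of y] assms(5,6) by simp_all
  then show ?thesis
    using Q.inv_solve_right[of "\<one>\<^bsub>Q\<^esub>" "p x" "p y"] unfolding eq by auto
qed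

text \<open>The quotients enter as surjections \<open>p1\<close>, \<open>p2\<close> with kernels
  \<open>H1\<close>, \<open>H2\<close>. An isomorphism gives its fibre product. Conversely, a
  subgroup \<open>K\<close> with the prescribed projections and intersections relates
  \<open>p1 a\<close> to \<open>p2 b\<close> for \<open>(a, b)\<close> in \<open>K\<close>, and the
  intersections make this relation a bijection.\<close>

lemma goursat_bij_betw:
  fixes A (structure) and B (structure)
  assumes A: "group A" "subgroup G1 A" and B: "group B" "subgroup G2 B"
    and Q1: "group Q1" "p1 \<in> hom (A\<lparr>carrier := G1\<rparr>) Q1" "p1 ` G1 = carrier Q1"
    and Q2: "group Q2" "p2 \<in> hom (B\<lparr>carrier := G2\<rparr>) Q2" "p2 ` G2 = carrier Q2"
    and H1: "H1 = {a \<in> G1. p1 a = \<one>\<^bsub>Q1\<^esub>}" and H2: "H2 = {b \<in> G2. p2 b = \<one>\<^bsub>Q2\<^esub>}"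
  shows "bij_betw (\<lambda>\<theta>. {(a, b). a \<in> G1 \<and> b \<in> G2 \<and> \<theta> (p1 a) = p2 b}) (isos Q1 Q2)
    {K. subgroup K (A \<times>\<times> B) \<and> fst ` K = G1 \<and> snd ` K = G2 \<and>
        {a. (a, \<one>\<^bsub>B\<^esub>) \<in> K} = H1 \<and> {b. (\<one>, b) \<in> K} = H2}"
    (is "bij_betw ?F _ ?S")
proof -
  interpret A: group A by fact
  interpret B: group B by fact
  interpret AB: group "A \<times>\<times> B" by (intro DirProd_group A B)
  interpret G1: subgroup G1 A by fact
  interpret G2: subgroup G2 B by fact
  interpret Q1: group Q1 by fact
  interpret Q2: group Q2 by fact
  interpret AG1: group "A\<lparr>carrier := G1\<rparr>" by (intro A.subgroup_imp_group A)
  interpret BG2: group "B\<lparr>carrier := G2\<rparr>" by (intro B.subgroup_imp_group B)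
  interpret p1: group_hom "A\<lparr>carrier := G1\<rparr>" Q1 p1 by unfold_locales (fact Q1)
  interpret p2: group_hom "B\<lparr>carrier := G2\<rparr>" Q2 p2 by unfold_locales (fact Q2)
  note ker1 = hom_eq_iff_kernel[OF A Q1(1,2)] and ker2 = hom_eq_iff_kernel[OF B Q2(1,2)]
  have p1m: "p1 (x \<otimes> y) = p1 x \<otimes>\<^bsub>Q1\<^esub> p1 y" if "x \<in> G1" "y \<in> G1" for x y
    using p1.hom_mult[of x y] that by simp
  have p2m: "p2 (x \<otimes>\<^bsub>B\<^esub> y) = p2 x \<otimes>\<^bsub>Q2\<^esub> p2 y" if "x \<in> G2" "y \<in> G2" for x y
    using p2.hom_mult[of x y] that by simp
  have p1i: "p1 (inv x) = inv\<^bsub>Q1\<^esub> p1 x" if "x \<in> G1" for x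
    using p1.hom_inv[of x] that by (simp add: A.m_inv_consistent[OF A(2) that])
  have p2i: "p2 (inv\<^bsub>B\<^esub> x) = inv\<^bsub>Q2\<^esub> p2 x" if "x \<in> G2" for x
    using p2.hom_inv[of x] that by (simp add: B.m_inv_consistent[OF B(2) that])
  have p1c: "p1 x \<in> carrier Q1" if "x \<in> G1" for x using that Q1 by auto
  have p2c: "p2 x \<in> carrier Q2" if "x \<in> G2" for x using that Q2 by auto
  have p1o: "p1 \<one> = \<one>\<^bsub>Q1\<^esub>" and p2o: "p2 \<one>\<^bsub>B\<^esub> = \<one>\<^bsub>Q2\<^esub>" using p1.hom_one p2.hom_one by simp_all
  show ?thesis
  proof (rule bij_betw_imageI)
    show "inj_on ?F (isos Q1 Q2)"
    proof (rule inj_onI)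
      fix \<theta> \<theta>' assume t: "\<theta> \<in> isos Q1 Q2" "\<theta>' \<in> isos Q1 Q2" "?F \<theta> = ?F \<theta>'"
      show "\<theta> = \<theta>'"
      proof (rule extensionalityI)
        show "\<theta> \<in> extensional (carrier Q1)" "\<theta>' \<in> extensional (carrier Q1)"
          using t by (auto simp: isos_def)
        \<comment> \<open>Every pair \<open>(q, \<theta> q)\<close> lifts to a member of the fibre
          product, which therefore determines \<open>\<theta>\<close>.\<close>
        fix q assume "q \<in> carrier Q1"
        then obtain a where a: "a \<in> G1" "q = p1 a" using Q1 by auto
        have "\<theta> q \<in> carrier Q2" using t \<open>q \<in> carrier Q1\<close> by (auto simp: isos_def iso_iff)
        then obtain b where b: "b \<in> G2" "\<theta> q = p2 b" using Q2 by auto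
        have "(a, b) \<in> ?F \<theta>" using a b by simp
        then have "(a, b) \<in> ?F \<theta>'" using t by simp
        then show "\<theta> q = \<theta>' q" using a b by simp
      qed
    qed
    have into: "?F \<theta> \<in> ?S" if "\<theta> \<in> isos Q1 Q2" for \<theta>
    proof -
      have iso: "\<theta> \<in> hom Q1 Q2" "inj_on \<theta> (carrier Q1)" "\<theta> ` carrier Q1 = carrier Q2"
        using that by (auto simp: isos_def iso_iff)
      interpret \<theta>: group_hom Q1 Q2 \<theta> by unfold_locales (fact iso)
      have "subgroup (?F \<theta>) (A \<times>\<times> B)"
      proof (rule AB.subgroupI)
        show "?F \<theta> \<subseteq> carrier (A \<times>\<times> B)" by auto
        have "(\<one>, \<one>\<^bsub>B\<^esub>) \<in> ?F \<theta>" by (simp add: p1o p2o)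
        then show "?F \<theta> \<noteq> {}" by blast
        show "inv\<^bsub>A \<times>\<times> B\<^esub> x \<in> ?F \<theta>" if "x \<in> ?F \<theta>" for x
          using that by (auto simp: inv_DirProd A B p1i p2i p1c)
        show "x \<otimes>\<^bsub>A \<times>\<times> B\<^esub> y \<in> ?F \<theta>" if "x \<in> ?F \<theta>" "y \<in> ?F \<theta>" for x y
          using that by (auto simp: p1m p2m p1c)
      qed
      moreover have "fst ` ?F \<theta> = G1"
      proof (intro equalityI subsetI)
        fix a assume a: "a \<in> G1"
        then have "\<theta> (p1 a) \<in> p2 ` G2" unfolding Q2 using iso(3) p1c by blast
        then obtain b where "b \<in> G2" "\<theta> (p1 a) = p2 b" by auto
        with a show "a \<in> fst ` ?F \<theta>" by (intro image_eqI[of _ _ "(a, b)"]) auto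
      qed auto
      moreover have "snd ` ?F \<theta> = G2"
      proof (intro equalityI subsetI)
        fix b assume b: "b \<in> G2"
        then have "p2 b \<in> \<theta> ` p1 ` G1" unfolding Q1 using iso(3) p2c by blast
        then obtain a where "a \<in> G1" "\<theta> (p1 a) = p2 b" by auto
        with b show "b \<in> snd ` ?F \<theta>" by (intro image_eqI[of _ _ "(a, b)"]) auto
      qed auto
      \<comment> \<open>Injectivity of \<open>\<theta>\<close> identifies the first intersection;
        that \<open>\<theta>\<close> preserves the identity identifies the second.\<close>
      moreover have "\<theta> (p1 a) = \<one>\<^bsub>Q2\<^esub> \<longleftrightarrow> p1 a = \<one>\<^bsub>Q1\<^esub>" if "a \<in> G1" for a
        using iso(2) p1c[OF that] \<theta>.hom_one by (metis inj_onD Q1.one_closed)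
      then have "{a. (a, \<one>\<^bsub>B\<^esub>) \<in> ?F \<theta>} = H1" "{b. (\<one>, b) \<in> ?F \<theta>} = H2"
        by (auto simp: H1 H2 p1o p2o)
      ultimately show ?thesis by blast
    qed
    have onto: "K \<in> ?F ` isos Q1 Q2" if K: "K \<in> ?S" for K
    proof -
      have KAB: "subgroup K (A \<times>\<times> B)" and K1: "fst ` K = G1" and K2: "snd ` K = G2"
        and KH1: "{a. (a, \<one>\<^bsub>B\<^esub>) \<in> K} = H1" and KH2: "{b. (\<one>, b) \<in> K} = H2"
        using K by blast+
      interpret K: subgroup K "A \<times>\<times> B" by (fact KAB)
      have G12: "a \<in> G1" "b \<in> G2" if "(a, b) \<in> K" for a b
        using imageI[OF that, of fst] imageI[OF that, of snd] by (simp_all add: K1 K2)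
      have div: "(a \<otimes> inv a', b \<otimes>\<^bsub>B\<^esub> inv\<^bsub>B\<^esub> b') \<in> K" if "(a, b) \<in> K" "(a', b') \<in> K" for a b a' b'
      proof -
        have "inv\<^bsub>A \<times>\<times> B\<^esub> (a', b') = (inv a', inv\<^bsub>B\<^esub> b')"
          using that G12 by (intro inv_DirProd A B) auto
        then show ?thesis
          using K.m_closed[OF that(1) K.m_inv_closed[OF that(2)]] by simp
      qed
      have H1K: "a \<in> H1 \<longleftrightarrow> (a, \<one>\<^bsub>B\<^esub>) \<in> K" and H2K: "b \<in> H2 \<longleftrightarrow> (\<one>, b) \<in> K" for a b
        unfolding KH1[symmetric] KH2[symmetric] by simp_all
      \<comment> \<open>The quotient of the two pairs is some \<open>(x, y)\<close> in
        \<open>K\<close>, and \<open>(x, \<one>)\<close> lies in \<open>K\<close> iff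
        \<open>(\<one>, y)\<close> does. One direction makes \<open>\<theta>\<close> below well
        defined, the other makes it injective.\<close>
      have key: "p1 a = p1 a' \<longleftrightarrow> p2 b = p2 b'" if ab: "(a, b) \<in> K" "(a', b') \<in> K" for a b a' b'
      proof -
        let ?x = "a \<otimes> inv a'" and ?y = "b \<otimes>\<^bsub>B\<^esub> inv\<^bsub>B\<^esub> b'"
        have xy: "(?x, ?y) \<in> K" by (rule div[OF ab])
        have "(?x, \<one>\<^bsub>B\<^esub>) \<in> K \<longleftrightarrow> (\<one>, ?y) \<in> K"
          using div[OF xy, of ?x "\<one>\<^bsub>B\<^esub>"] div[OF xy, of "\<one>" ?y] xy G12[OF xy] by auto
        then show ?thesis
          using ab xy ker1[of a a'] ker2[of b b'] H1K[of ?x] H2K[of ?y] G12 by (auto simp: H1 H2)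
      qed
      \<comment> \<open>Any \<open>b\<close> paired with a preimage of \<open>q\<close> may be
        chosen: by \<open>key\<close> the value does not depend on the choice.\<close>
      define \<theta> where "\<theta> = (\<lambda>q\<in>carrier Q1. p2 (SOME b. \<exists>a. (a, b) \<in> K \<and> p1 a = q))"
      have \<theta>: "\<theta> (p1 a) = p2 b" if ab: "(a, b) \<in> K" for a b
      proof -
        have "\<exists>b'. \<exists>a'. (a', b') \<in> K \<and> p1 a' = p1 a" using ab by blast
        from someI_ex[OF this] obtain a' where
          "(a', SOME b. \<exists>a'. (a', b) \<in> K \<and> p1 a' = p1 a) \<in> K" "p1 a' = p1 a" by blast
        then show ?thesis
          using key[OF _ ab] p1c G12[OF ab] by (simp add: \<theta>_def)
      qed
      have ex1: "\<exists>b. (a, b) \<in> K" if "a \<in> G1" for a using that unfolding K1[symmetric] by force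
      have ex2: "\<exists>a. (a, b) \<in> K" if "b \<in> G2" for b using that unfolding K2[symmetric] by force
      have "\<theta> \<in> isos Q1 Q2"
        unfolding isos_def Int_iff iso_iff
      proof (intro conjI)
        show "\<theta> \<in> extensional (carrier Q1)" by (simp add: \<theta>_def)
        show "\<theta> \<in> hom Q1 Q2"
        proof (rule homI)
          show "\<theta> q \<in> carrier Q2" if "q \<in> carrier Q1" for q
            using that Q1(3) ex1 \<theta> G12 p2c by (metis imageE)
          fix q q' assume "q \<in> carrier Q1" "q' \<in> carrier Q1"
          then obtain a a' where a: "a \<in> G1" "a' \<in> G1" "q = p1 a" "q' = p1 a'"
            unfolding Q1(3)[symmetric] by blast
          obtain b b' where b: "(a, b) \<in> K" "(a', b') \<in> K"
            using ex1[OF a(1)] ex1[OF a(2)] by blast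
          then have "(a \<otimes> a', b \<otimes>\<^bsub>B\<^esub> b') \<in> K" using K.m_closed[OF b] by simp
          then show "\<theta> (q \<otimes>\<^bsub>Q1\<^esub> q') = \<theta> q \<otimes>\<^bsub>Q2\<^esub> \<theta> q'"
            using \<theta>[OF b(1)] \<theta>[OF b(2)] \<theta>[of "a \<otimes> a'" "b \<otimes>\<^bsub>B\<^esub> b'"]
              p2m[OF G12(2)[OF b(1)] G12(2)[OF b(2)]]
            unfolding a(3,4) p1m[OF a(1,2)] by simp
        qed
        show "\<theta> ` carrier Q1 = carrier Q2"
          unfolding Q1(3)[symmetric] Q2(3)[symmetric] image_image
        proof (intro equalityI image_subsetI)
          fix a assume "a \<in> G1"
          then obtain b where "(a, b) \<in> K" using ex1 by blast
          then show "\<theta> (p1 a) \<in> p2 ` G2" using \<theta>[of a b] G12(2) by blast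
        next
          fix b assume "b \<in> G2"
          then obtain a where "(a, b) \<in> K" using ex2 by blast
          then show "p2 b \<in> (\<lambda>a. \<theta> (p1 a)) ` G1" using \<theta>[of a b, symmetric] G12(1) by blast
        qed
        show "inj_on \<theta> (carrier Q1)"
          unfolding Q1(3)[symmetric]
          by (rule inj_onI) (metis (no_types, lifting) imageE ex1 \<theta> key)
      qed
      moreover have "?F \<theta> = K"
      proof (intro equalityI subrelI)
        fix a b assume "(a, b) \<in> ?F \<theta>"
        then have ab: "a \<in> G1" "b \<in> G2" "\<theta> (p1 a) = p2 b" by auto
        \<comment> \<open>\<open>b\<close> and \<open>b'\<close> have the same image under
          \<open>p2\<close>, so they differ by an element of \<open>H2\<close>, which lies in
          \<open>K\<close> next to the identity.\<close>
        then obtain b' where b': "(a, b') \<in> K" using ex1 by blast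
        then have "p2 b = p2 b'" using \<theta>[OF b'] ab by simp
        then have "(\<one>, b \<otimes>\<^bsub>B\<^esub> inv\<^bsub>B\<^esub> b') \<in> K"
          using ker2[of b b'] ab G12[OF b'] H2K[of "b \<otimes>\<^bsub>B\<^esub> inv\<^bsub>B\<^esub> b'"] by (auto simp: H2)
        from K.m_closed[OF this b'] show "(a, b) \<in> K"
          using ab G12[OF b'] by (simp add: B.m_assoc)
      next
        fix a b assume "(a, b) \<in> K"
        then show "(a, b) \<in> ?F \<theta>" using \<theta> G12 by auto
      qed
      ultimately show ?thesis by blast
    qed
    show "?F ` isos Q1 Q2 = ?S"
    proof (rule equalityI)
      show "?F ` isos Q1 Q2 \<subseteq> ?S" by (rule image_subsetI) (rule into)
      show "?S \<subseteq> ?F ` isos Q1 Q2" by (rule subsetI) (rule onto)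
    qed
  qed
qed

section \<open>Subquotients and the summed form of Goursat's lemma\<close>

definition sections :: "('a, 'b) monoid_scheme \<Rightarrow> ('a set \<times> 'a set) set" where
  "sections A = {(G, H). subgroup G A \<and> subgroup H A \<and> H \<subseteq> G}"

abbreviation subquotient :: "('a, 'b) monoid_scheme \<Rightarrow> 'a set \<times> 'a set \<Rightarrow> 'a set monoid" where
  "subquotient A \<equiv> \<lambda>(G, H). A\<lparr>carrier := G\<rparr> Mod H"

text \<open>The projections of \<open>K\<close> and its intersections with the factors, grouped so
  that each component is a section of one factor.\<close>

definition goursat where
  "goursat A B K = ((fst ` K, {a. (a, \<one>\<^bsub>B\<^esub>) \<in> K}), (snd ` K, {b. (\<one>\<^bsub>A\<^esub>, b) \<in> K}))"

lemma (in comm_group) comm_group_subgroup: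
  assumes "subgroup H G"
  shows "comm_group (G\<lparr>carrier := H\<rparr>)"
  using subgroup.mem_carrier[OF assms] m_comm
  by (intro group.group_comm_groupI subgroup_imp_group assms) auto

text \<open>Puts the coset map into the form that Goursat's lemma takes: a homomorphism from
  \<open>K\<close> onto the quotient, with kernel \<open>H\<close>.\<close>

lemma (in comm_group) section_quotient:
  assumes "(K, H) \<in> sections G"
  shows "comm_group (G\<lparr>carrier := K\<rparr> Mod H)"
    and "(\<lambda>x. H #> x) \<in> hom (G\<lparr>carrier := K\<rparr>) (G\<lparr>carrier := K\<rparr> Mod H)"
    and "(\<lambda>x. H #> x) ` K = carrier (G\<lparr>carrier := K\<rparr> Mod H)"
    and "H = {x \<in> K. H #> x = \<one>\<^bsub>G\<lparr>carrier := K\<rparr> Mod H\<^esub>}"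
proof -
  have KH: "subgroup K G" "subgroup H G" "H \<subseteq> K" using assms by (auto simp: sections_def)
  interpret K: comm_group "G\<lparr>carrier := K\<rparr>" by (intro comm_group_subgroup KH)
  have H: "subgroup H (G\<lparr>carrier := K\<rparr>)" using KH by (simp add: subgroup_incl)
  then have N: "normal H (G\<lparr>carrier := K\<rparr>)" by (simp add: K.normal_iff_subgroup)
  have eq: "H #>\<^bsub>G\<lparr>carrier := K\<rparr>\<^esub> x = H #> x" for x by (simp add: r_coset_def)
  show "comm_group (G\<lparr>carrier := K\<rparr> Mod H)" by (rule K.abelian_FactGroup[OF H])
  show "(\<lambda>x. H #> x) \<in> hom (G\<lparr>carrier := K\<rparr>) (G\<lparr>carrier := K\<rparr> Mod H)"
    using normal.r_coset_hom_Mod[OF N] by (simp add: eq)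
  show "(\<lambda>x. H #> x) ` K = carrier (G\<lparr>carrier := K\<rparr> Mod H)"
    by (simp add: carrier_FactGroup eq)
  have "H #> x = H \<longleftrightarrow> x \<in> H" if "x \<in> K" for x
    using KH that by (metis coset_join1 coset_join2 subgroup.mem_carrier)
  then show "H = {x \<in> K. H #> x = \<one>\<^bsub>G\<lparr>carrier := K\<rparr> Mod H\<^esub>}"
    using KH by auto
qed

lemma goursat_in_sections:
  assumes "group A" "group B" "subgroup K (A \<times>\<times> B)"
  shows "goursat A B K \<in> sections A \<times> sections B"
proof -
  interpret A: group A by fact
  interpret B: group B by fact
  interpret AB: group "A \<times>\<times> B" by (intro DirProd_group assms)
  interpret K: subgroup K "A \<times>\<times> B" by fact
  have f: "group_hom (A \<times>\<times> B) A fst" and s: "group_hom (A \<times>\<times> B) B snd"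
    by unfold_locales (auto simp: hom_def)
  have inv: "(inv\<^bsub>A\<^esub> a, inv\<^bsub>B\<^esub> b) \<in> K" if "(a, b) \<in> K" for a b
  proof -
    have "a \<in> carrier A" "b \<in> carrier B" using K.subset that by auto
    with K.m_inv_closed[OF that] show ?thesis by (simp only: inv_DirProd[OF assms(1,2)])
  qed
  have "subgroup {a. (a, \<one>\<^bsub>B\<^esub>) \<in> K} A"
  proof (rule A.subgroupI)
    show "{a. (a, \<one>\<^bsub>B\<^esub>) \<in> K} \<subseteq> carrier A" using K.subset by auto
    show "{a. (a, \<one>\<^bsub>B\<^esub>) \<in> K} \<noteq> {}" using K.one_closed by auto
    show "inv\<^bsub>A\<^esub> a \<in> {a. (a, \<one>\<^bsub>B\<^esub>) \<in> K}" if "a \<in> {a. (a, \<one>\<^bsub>B\<^esub>) \<in> K}" for a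
      using inv[of a "\<one>\<^bsub>B\<^esub>"] that by simp
    show "a \<otimes>\<^bsub>A\<^esub> b \<in> {a. (a, \<one>\<^bsub>B\<^esub>) \<in> K}" if "a \<in> {a. (a, \<one>\<^bsub>B\<^esub>) \<in> K}" "b \<in> {a. (a, \<one>\<^bsub>B\<^esub>) \<in> K}" for a b
      using K.m_closed[of "(a, \<one>\<^bsub>B\<^esub>)" "(b, \<one>\<^bsub>B\<^esub>)"] that by simp
  qed
  moreover have "subgroup {b. (\<one>\<^bsub>A\<^esub>, b) \<in> K} B"
  proof (rule B.subgroupI)
    show "{b. (\<one>\<^bsub>A\<^esub>, b) \<in> K} \<subseteq> carrier B" using K.subset by auto
    show "{b. (\<one>\<^bsub>A\<^esub>, b) \<in> K} \<noteq> {}" using K.one_closed by auto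
    show "inv\<^bsub>B\<^esub> b \<in> {b. (\<one>\<^bsub>A\<^esub>, b) \<in> K}" if "b \<in> {b. (\<one>\<^bsub>A\<^esub>, b) \<in> K}" for b
      using inv[of "\<one>\<^bsub>A\<^esub>" b] that by simp
    show "a \<otimes>\<^bsub>B\<^esub> b \<in> {b. (\<one>\<^bsub>A\<^esub>, b) \<in> K}" if "a \<in> {b. (\<one>\<^bsub>A\<^esub>, b) \<in> K}" "b \<in> {b. (\<one>\<^bsub>A\<^esub>, b) \<in> K}" for a b
      using K.m_closed[of "(\<one>\<^bsub>A\<^esub>, a)" "(\<one>\<^bsub>A\<^esub>, b)"] that by simp
  qed
  ultimately show ?thesis
    using group_hom.subgroup_img_is_subgroup[OF f assms(3)] group_hom.subgroup_img_is_subgroup[OF s assms(3)]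
    by (force simp: goursat_def sections_def)
qed

lemma finite_sections: "finite (carrier A) \<Longrightarrow> finite (sections A)"
  by (rule finite_subset[of _ "Pow (carrier A) \<times> Pow (carrier A)"])
     (auto simp: sections_def dest: subgroup.mem_carrier)

lemma finite_subgroups: "finite (carrier A) \<Longrightarrow> finite {H. subgroup H A}"
  by (rule finite_subset[of _ "Pow (carrier A)"]) (auto dest: subgroup.mem_carrier)

text \<open>The subgroups are grouped by the value of \<open>goursat\<close>; the fibre over
  \<open>(s, t)\<close> is in bijection with the isomorphisms between the two subquotients. With a
  constant weight this counts subgroups, with other weights it sums functions of their Goursat
  data.\<close>

theorem goursat_sum:
  fixes w :: "('a set \<times> 'a set) \<times> ('b set \<times> 'b set) \<Rightarrow> nat"
  assumes "comm_group A" "comm_group B" "finite (carrier A)" "finite (carrier B)"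
  shows "(\<Sum>K | subgroup K (A \<times>\<times> B). w (goursat A B K)) =
    (\<Sum>s\<in>sections A. \<Sum>t\<in>sections B. card (isos (subquotient A s) (subquotient B t)) * w (s, t))"
proof -
  interpret A: comm_group A by fact
  interpret B: comm_group B by fact
  have fin: "finite {K. subgroup K (A \<times>\<times> B)}"
    using assms by (intro finite_subgroups) simp
  have fibre: "card {K. subgroup K (A \<times>\<times> B) \<and> goursat A B K = (s, t)} =
      card (isos (subquotient A s) (subquotient B t))"
    if "s \<in> sections A" "t \<in> sections B" for s t
  proof -
    obtain G1 H1 G2 H2 where st: "s = (G1, H1)" "t = (G2, H2)" by fastforce
    have sg: "subgroup G1 A" "subgroup G2 B" using that st by (auto simp: sections_def)
    note q1 = A.section_quotient[OF that(1)[unfolded st]] and q2 = B.section_quotient[OF that(2)[unfolded st]]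
    have "{K. subgroup K (A \<times>\<times> B) \<and> goursat A B K = (s, t)} =
      {K. subgroup K (A \<times>\<times> B) \<and> fst ` K = G1 \<and> snd ` K = G2 \<and>
        {a. (a, \<one>\<^bsub>B\<^esub>) \<in> K} = H1 \<and> {b. (\<one>\<^bsub>A\<^esub>, b) \<in> K} = H2}"
      by (auto simp: goursat_def st)
    then show ?thesis
      using bij_betw_same_card[OF goursat_bij_betw[OF A.is_group sg(1) B.is_group sg(2)
          comm_group.axioms(2)[OF q1(1)] q1(2,3) comm_group.axioms(2)[OF q2(1)] q2(2,3) q1(4) q2(4)]]
      by (simp add: st)
  qed
  have "(\<Sum>K | subgroup K (A \<times>\<times> B). w (goursat A B K)) =
    (\<Sum>st\<in>sections A \<times> sections B. \<Sum>K\<in>{K\<in>{K. subgroup K (A \<times>\<times> B)}. goursat A B K = st}. w (goursat A B K))"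
    using goursat_in_sections[OF A.is_group B.is_group]
    by (intro sum.group[symmetric] finite_cartesian_product finite_sections assms fin image_subsetI) simp
  also have "\<dots> = (\<Sum>(s,t)\<in>sections A \<times> sections B. card (isos (subquotient A s) (subquotient B t)) * w (s, t))"
    by (intro sum.cong refl) (auto simp: fibre)
  finally show ?thesis by (simp add: sum.cartesian_product)
qed

section \<open>Cyclic groups\<close>

lemma (in group) cyclic_group_iso_integer_mod_group:
  assumes "cyclic_group G" "finite (carrier G)"
  shows "G \<cong> integer_mod_group (order G)"
proof -
  obtain x where x: "x \<in> carrier G" and gen: "carrier G = range (\<lambda>k::int. x [^] k)"
    using assms cyclic_group by auto
  define d where "d = order G"
  have d: "d > 0" using assms order_gt_0_iff_finite by (simp add: d_def)
  have od: "ord x = d" using cyclic_ord[OF x gen] by (simp add: d_def)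
  have xm: "x [^] (k mod int d) = x [^] k" for k :: int
    using x d_def by (intro int_pow_mod_order is_group) (auto simp: pow_order_eq_1)
  interpret Z: group "integer_mod_group d" by simp
  interpret f: group_hom "integer_mod_group d" G "\<lambda>k::int. x [^] k"
    by unfold_locales (auto simp: hom_def x xm int_pow_mult)
  have "(\<lambda>k::int. x [^] k) \<in> iso (integer_mod_group d) G"
    unfolding f.iso_iff
  proof (intro conjI subsetI ballI impI)
    fix y assume "y \<in> carrier G"
    then obtain k :: int where "y = x [^] k" using gen by auto
    then have "y = x [^] (k mod int d)" by (simp add: xm)
    then show "y \<in> (\<lambda>k::int. x [^] k) ` carrier (integer_mod_group d)"
      by (rule image_eqI) (simp add: carrier_integer_mod_group d)
  next
    fix k :: int assume k: "k \<in> carrier (integer_mod_group d)" "x [^] k = \<one>"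
    then have "int d dvd k" using x od by (simp add: int_pow_eq_id)
    moreover have "0 \<le> k" "k < int d" using k d by (auto simp: carrier_integer_mod_group)
    ultimately have "k = 0" by (metis zdvd_not_zless order_less_le)
    then show "k = \<one>\<^bsub>integer_mod_group d\<^esub>" by simp
  qed
  then show ?thesis using Z.iso_sym is_isoI unfolding d_def by blast
qed

text \<open>An endomorphism is multiplication by the image \<open>k\<close> of 1, and it is
  bijective iff \<open>k\<close> is coprime to \<open>d\<close>.\<close>

lemma card_isos_integer_mod_group:
  assumes "d > 0"
  shows "card (isos (integer_mod_group d) (integer_mod_group d)) = totient d"
proof -
  let ?Z = "integer_mod_group d" and ?D = "int d"
  let ?U = "{k \<in> {0..<?D}. coprime k ?D}"
  let ?f = "\<lambda>k. \<lambda>x\<in>carrier ?Z. (k * x) mod ?D"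
  have carr: "carrier ?Z = {0..<?D}" using assms by (simp add: carrier_integer_mod_group)
  have one: "1 mod ?D \<in> carrier ?Z" using assms by (simp add: carr)
  have "bij_betw ?f ?U (isos ?Z ?Z)"
  proof (rule bij_betw_imageI)
    show "inj_on ?f ?U"
    proof (rule inj_onI)
      fix k l assume kl: "k \<in> ?U" "l \<in> ?U" "?f k = ?f l"
      then have "?f k (1 mod ?D) = ?f l (1 mod ?D)" by simp
      then show "k = l" using one kl(1,2) by (simp add: mod_mult_right_eq)
    qed
    have into: "?f k \<in> isos ?Z ?Z" if "k \<in> ?U" for k
    proof -
      have "?f k \<in> hom ?Z ?Z"
      proof (rule homI)
        show "?f k x \<in> carrier ?Z" if "x \<in> carrier ?Z" for x
          using that assms by (simp add: carr)
        show "?f k (x \<otimes>\<^bsub>?Z\<^esub> y) = ?f k x \<otimes>\<^bsub>?Z\<^esub> ?f k y" if "x \<in> carrier ?Z" "y \<in> carrier ?Z" for x y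
        proof -
          have "(x + y) mod ?D \<in> carrier ?Z" using assms by (simp add: carr)
          then show ?thesis
            using that by (simp add: mod_mult_right_eq mod_add_eq distrib_left)
        qed
      qed
      moreover have inj: "inj_on (?f k) (carrier ?Z)"
      proof (rule inj_onI)
        fix x y assume xy: "x \<in> carrier ?Z" "y \<in> carrier ?Z" "?f k x = ?f k y"
        then have "[k * x = k * y] (mod ?D)" by (simp add: cong_def)
        then have "[x = y] (mod ?D)" using that by (simp add: cong_mult_lcancel coprime_commute)
        then show "x = y" using xy(1,2) by (simp add: cong_def carr)
      qed
      moreover have "?f k ` carrier ?Z = carrier ?Z"
        using inj assms by (intro endo_inj_surj) (auto simp: carr)
      ultimately show ?thesis by (simp add: isos_def iso_iff)
    qed
    have onto: "f \<in> ?f ` ?U" if f: "f \<in> isos ?Z ?Z" for f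
    proof -
      define k where "k = f (1 mod ?D)"
      have hom: "f \<in> hom ?Z ?Z" and surj: "f ` carrier ?Z = carrier ?Z" and ext: "f \<in> extensional (carrier ?Z)"
        using f by (auto simp: isos_def iso_iff)
      have k: "k \<in> carrier ?Z" unfolding k_def using one surj by blast
      have fx: "f x = (k * x) mod ?D" if "x \<in> carrier ?Z" for x
      proof -
        have "x = (1 mod ?D) [^]\<^bsub>?Z\<^esub> x"
          using that by (simp add: int_pow_integer_mod_group mod_mult_right_eq carr)
        then have "f x = f ((1 mod ?D) [^]\<^bsub>?Z\<^esub> x)" by simp
        also have "\<dots> = k [^]\<^bsub>?Z\<^esub> x"
          using hom_int_pow[OF hom one] by (simp add: k_def)
        finally show ?thesis by (simp add: int_pow_integer_mod_group mult.commute)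
      qed
      \<comment> \<open>Surjectivity reaches 1, so \<open>k\<close> is invertible modulo
        \<open>d\<close>.\<close>
      have "1 mod ?D \<in> f ` carrier ?Z" using one surj by simp
      then obtain x where "x \<in> carrier ?Z" "1 mod ?D = f x" by blast
      then have "[k * x = 1] (mod ?D)" using fx by (simp add: cong_def)
      then have "coprime k ?D" using coprime_iff_invertible_int by blast
      moreover have "f = ?f k" by (rule extensionalityI[OF ext]) (auto simp: fx)
      ultimately show ?thesis using k by (auto simp: carr)
    qed
    show "?f ` ?U = isos ?Z ?Z"
      by (rule equalityI; rule image_subsetI subsetI; rule into onto)
  qed
  from bij_betw_same_card[OF this] have "card (isos ?Z ?Z) = card ?U" by (rule sym)
  also have "\<dots> = card (totatives d)"
  \<comment> \<open>For \<open>d = 1\<close> the unit residue is 0 whereas \<open>totatives\<close>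
    contains 1; for larger \<open>d\<close> the two sets agree.\<close>
  proof (cases "d = 1")
    case True
    then have "?U = {0}" by auto
    then show ?thesis using True by simp
  next
    case False
    with assms have d: "d > 1" by simp
    have "?U = int ` totatives d"
    proof (intro equalityI subsetI)
      fix k assume k: "k \<in> ?U"
      then have "k \<noteq> 0" using d by auto
      with k have "nat k \<in> totatives d" "k = int (nat k)"
        by (auto simp: in_totatives_iff coprime_int_iff[symmetric])
      then show "k \<in> int ` totatives d" by blast
    next
      fix k assume "k \<in> int ` totatives d"
      then show "k \<in> ?U" using d totatives_less by (auto simp: in_totatives_iff)
    qed
    then show ?thesis by (simp add: card_image)
  qed
  finally show ?thesis by (simp add: totient_def)
qed

text \<open>Finite cyclic groups are classified by their order, so the isomorphisms can be counted
  on a residue class group.\<close>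

lemma card_isos_cyclic:
  assumes "group G" "cyclic_group G" "finite (carrier G)" "group H" "cyclic_group H" "finite (carrier H)"
  shows "card (isos G H) = (if order G = order H then totient (order G) else 0)"
proof (cases "order G = order H")
  case True
  have "order G > 0" using assms monoid.order_gt_0_iff_finite[OF group.is_monoid] by blast
  moreover have "card (isos G H) = card (isos (integer_mod_group (order G)) (integer_mod_group (order G)))"
    using assms group.cyclic_group_iso_integer_mod_group[of G] group.cyclic_group_iso_integer_mod_group[of H] True
    by (intro card_isos_cong) auto
  ultimately show ?thesis using True by (simp add: card_isos_integer_mod_group)
next
  case False
  then have "\<not> G \<cong> H" using iso_same_card by (auto simp: order_def)
  then show ?thesis using False by (simp add: card_isos_eq_0)
qed

text \<open>The exponents \<open>i\<close> with \<open>x [^] i\<close> in \<open>K\<close> are the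
  multiples of one \<open>a\<close>, so \<open>x [^] a\<close> generates \<open>K\<close>.\<close>

lemma (in group) cyclic_group_subgroup:
  assumes "cyclic_group G" "subgroup K G"
  shows "cyclic_group (G\<lparr>carrier := K\<rparr>)"
proof -
  interpret K: subgroup K G by fact
  interpret GK: group "G\<lparr>carrier := K\<rparr>" by (intro subgroup_imp_group assms)
  obtain x where x [simp]: "x \<in> carrier G" and gen: "carrier G = range (\<lambda>k::int. x [^] k)"
    using assms cyclic_group by auto
  obtain a where a: "{i::int. x [^] i \<in> K} = range (\<lambda>k. a * k)"
  proof (rule int_subgroup_principal)
    show "0 \<in> {i::int. x [^] i \<in> K}" by simp
    show "i - j \<in> {i::int. x [^] i \<in> K}" if "i \<in> {i::int. x [^] i \<in> K}" "j \<in> {i::int. x [^] i \<in> K}" for i j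
      using that by (auto simp: int_pow_diff)
  qed
  have "a * 1 \<in> {i::int. x [^] i \<in> K}" unfolding a by blast
  then have xa: "x [^] a \<in> K" by simp
  have "y \<in> range (\<lambda>k::int. (x [^] a) [^] k)" if "y \<in> K" for y
  proof -
    have "y \<in> range (\<lambda>k::int. x [^] k)" using that K.subset gen by blast
    then obtain i :: int where i: "y = x [^] i" by blast
    with that have "i \<in> {i::int. x [^] i \<in> K}" by simp
    then obtain k where "i = a * k" unfolding a by blast
    then show ?thesis by (simp add: i int_pow_pow)
  qed
  moreover have "(x [^] a) [^] k \<in> K" for k :: int
    by (rule subgroup_int_pow_closed[OF assms(2) xa])
  ultimately have "K = range (\<lambda>k::int. (x [^] a) [^]\<^bsub>G\<lparr>carrier := K\<rparr>\<^esub> k)"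
    unfolding int_pow_consistent[OF assms(2) xa, symmetric] by blast
  then show ?thesis
    using xa by (auto simp: GK.cyclic_group)
qed

lemma card_FactGroup:
  fixes G (structure)
  assumes "group G" "subgroup K G" "subgroup H G" "H \<subseteq> K"
  shows "order (G\<lparr>carrier := K\<rparr> Mod H) * card H = card K"
proof -
  interpret group G by fact
  interpret K: group "G\<lparr>carrier := K\<rparr>" by (intro subgroup_imp_group assms)
  have "subgroup H (G\<lparr>carrier := K\<rparr>)" using assms by (simp add: subgroup_incl)
  from K.lagrange[OF this] show ?thesis by (simp add: order_def FactGroup_def)
qed

lemma (in comm_group) cyclic_group_subquotient:
  assumes "cyclic_group G" "(K, H) \<in> sections G"
  shows "cyclic_group (G\<lparr>carrier := K\<rparr> Mod H)"
proof -
  have K: "subgroup K G" using assms by (simp add: sections_def)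
  interpret K: group "G\<lparr>carrier := K\<rparr>" by (intro subgroup_imp_group K)
  note q = section_quotient[OF assms(2)]
  have "(\<lambda>x. H #> x) \<in> epi (G\<lparr>carrier := K\<rparr>) (G\<lparr>carrier := K\<rparr> Mod H)"
    using q(2,3) by (simp add: epi_def)
  then show ?thesis
    using K.cyclic_group_epimorphic_image cyclic_group_subgroup[OF assms(1) K] q(1)
    by (auto simp: comm_group_def)
qed

text \<open>The power of a coset is the coset of the power, and it is trivial iff that power lies in
  \<open>H\<close>.\<close>

lemma (in comm_group) gexp_subquotient_dvd_iff:
  assumes "(K, H) \<in> sections G"
  shows "gexp (G\<lparr>carrier := K\<rparr> Mod H) dvd k \<longleftrightarrow> (\<forall>x\<in>K. x [^] k \<in> H)"
proof -
  have KH: "subgroup K G" "subgroup H G" "H \<subseteq> K" using assms by (auto simp: sections_def)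
  interpret K: group "G\<lparr>carrier := K\<rparr>" by (intro subgroup_imp_group KH)
  note q = section_quotient[OF assms]
  interpret Q: comm_group "G\<lparr>carrier := K\<rparr> Mod H" by (rule q(1))
  interpret p: group_hom "G\<lparr>carrier := K\<rparr>" "G\<lparr>carrier := K\<rparr> Mod H" "\<lambda>x. H #> x"
    by unfold_locales (fact q(2))
  have "(H #> x) [^]\<^bsub>G\<lparr>carrier := K\<rparr> Mod H\<^esub> k = \<one>\<^bsub>G\<lparr>carrier := K\<rparr> Mod H\<^esub> \<longleftrightarrow> x [^] k \<in> H" if "x \<in> K" for x
  proof -
    have xk: "x [^]\<^bsub>G\<lparr>carrier := K\<rparr>\<^esub> k = x [^] k" by (rule nat_pow_consistent[symmetric])
    have "x [^] k \<in> K" using K.nat_pow_closed[of x k] that by (simp add: xk)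
    moreover have "(H #> x) [^]\<^bsub>G\<lparr>carrier := K\<rparr> Mod H\<^esub> k = H #> (x [^] k)"
      using p.hom_nat_pow[of x k] that by (simp add: xk)
    ultimately show ?thesis using q(4) by blast
  qed
  then show ?thesis
    unfolding Q.gexp_dvd_iff q(3)[symmetric] by blast
qed

section \<open>Subgroups of a residue class group as torsion subgroups\<close>

definition torsion :: "nat \<Rightarrow> nat \<Rightarrow> int set" where
  "torsion m d = {x \<in> carrier (integer_mod_group m). int m dvd int d * x}"

text \<open>With \<open>m = d * k\<close> the members are the multiples of \<open>k\<close> in the
  range from 0 to \<open>m - 1\<close>, of which there are \<open>d\<close>.\<close>

lemma card_torsion:
  assumes "d dvd m" "m > 0"
  shows "card (torsion m d) = d"
proof -
  obtain k where k: "m = d * k" using assms by auto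
  have dk: "d > 0" "k > 0" using assms k by auto
  have "torsion m d = (\<lambda>i. int k * i) ` {0..<int d}"
  proof (intro equalityI subsetI)
    fix x assume "x \<in> torsion m d"
    then have x: "0 \<le> x" "x < int k * int d" "int d * int k dvd int d * x"
      using assms by (auto simp: torsion_def carrier_integer_mod_group k mult.commute)
    then have "int k dvd x" using dk by simp
    then obtain i where i: "x = int k * i" by (elim dvdE)
    with x dk have "0 \<le> i" "i < int d" by (simp_all add: zero_le_mult_iff)
    with i show "x \<in> (\<lambda>i. int k * i) ` {0..<int d}" by auto
  next
    fix x assume "x \<in> (\<lambda>i. int k * i) ` {0..<int d}"
    then obtain i where "x = int k * i" "i \<in> {0..<int d}" by blast
    then show "x \<in> torsion m d"
      using dk by (auto simp: torsion_def carrier_integer_mod_group k mult.commute)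
  qed
  moreover have "inj_on (\<lambda>i. int k * i) {0..<int d}" using dk by (auto simp: inj_on_def)
  ultimately show ?thesis by (simp add: card_image)
qed

lemma subgroup_torsion:
  assumes "m > 0"
  shows "subgroup (torsion m d) (integer_mod_group m)"
proof (rule group.subgroupI)
  have red: "int m dvd a * (b mod int m) \<longleftrightarrow> int m dvd a * b" for a b
    by (metis dvd_eq_mod_eq_0 mod_mult_right_eq)
  show "torsion m d \<subseteq> carrier (integer_mod_group m)" by (auto simp: torsion_def)
  have "0 \<in> torsion m d" by (simp add: torsion_def)
  then show "torsion m d \<noteq> {}" by blast
  show "inv\<^bsub>integer_mod_group m\<^esub> x \<in> torsion m d" if "x \<in> torsion m d" for x
    using that assms by (auto simp: torsion_def carrier_integer_mod_group red)
  show "x \<otimes>\<^bsub>integer_mod_group m\<^esub> y \<in> torsion m d" if "x \<in> torsion m d" "y \<in> torsion m d" for x y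
    using that assms by (auto simp: torsion_def carrier_integer_mod_group red distrib_left)
qed simp

text \<open>By Lagrange every element of \<open>H\<close> is annihilated by \<open>card H\<close>,
  so \<open>H\<close> lies in that torsion subgroup; both have \<open>card H\<close>
  elements.\<close>

lemma subgroup_eq_torsion:
  assumes "subgroup H (integer_mod_group m)" "m > 0"
  shows "H = torsion m (card H)" "card H dvd m"
proof -
  interpret Z: group "integer_mod_group m" by simp
  interpret H: subgroup H "integer_mod_group m" by fact
  interpret ZH: group "integer_mod_group m\<lparr>carrier := H\<rparr>" by (intro Z.subgroup_imp_group assms)
  show dvd: "card H dvd m"
    using Z.lagrange[OF assms(1)] assms(2) by (metis dvd_triv_right order_integer_mod_group)
  have fin: "finite (torsion m (card H))"
    using assms finite_integer_mod_group by (auto simp: torsion_def)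
  have "H \<subseteq> torsion m (card H)"
  proof
    fix x assume x: "x \<in> H"
    have "x [^]\<^bsub>integer_mod_group m\<^esub> (card H) = \<one>\<^bsub>integer_mod_group m\<^esub>"
      using ZH.pow_order_eq_1[of x] x by (simp add: order_def Z.nat_pow_consistent[symmetric])
    then show "x \<in> torsion m (card H)"
      using x H.subset by (auto simp: torsion_def)
  qed
  then show "H = torsion m (card H)"
    using card_torsion[OF dvd assms(2)] fin by (intro card_subset_eq) auto
qed

lemma torsion_mono: "d dvd e \<Longrightarrow> torsion m d \<subseteq> torsion m e"
  by (auto simp: torsion_def intro: dvd_trans)

text \<open>A chain of subgroups H in G of Z_m is determined by the orders of its members. Here
  \<open>x1\<close> is the order of H, \<open>x3\<close> the index of H in G and \<open>x2\<close>
  the index of G in Z_m.\<close>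

lemma sum_sections_integer_mod_group:
  assumes "m > 0"
  shows "(\<Sum>s\<in>sections (integer_mod_group m). f s) =
    (\<Sum>(x1, x2, x3)\<in>{(x1, x2, x3). x1 * x2 * x3 = m}. f (torsion m (x1 * x3), torsion m x1))"
proof -
  let ?X = "{(x1, x2, x3). x1 * x2 * x3 = m}"
  let ?g = "\<lambda>(x1, x2, x3). (torsion m (x1 * x3), torsion m x1)"
  have "bij_betw ?g ?X (sections (integer_mod_group m))"
  proof (rule bij_betw_imageI)
    show "inj_on ?g ?X"
    proof (rule inj_onI)
      fix x y assume xy: "x \<in> ?X" "y \<in> ?X" "?g x = ?g y"
      obtain x1 x2 x3 y1 y2 y3 where e: "x = (x1, x2, x3)" "y = (y1, y2, y3)" by (metis prod_cases3)
      have m: "x1 * x2 * x3 = m" "y1 * y2 * y3 = m" using xy e by auto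
      have dvd: "a dvd m \<and> a * c dvd m" if "a * b * c = m" for a b c :: nat
      proof
        show "a dvd m" using that by auto
        have "m = a * c * b" using that by (simp add: mult_ac)
        then show "a * c dvd m" by (rule dvdI)
      qed
      have "x1 dvd m" "x1 * x3 dvd m" "y1 dvd m" "y1 * y3 dvd m"
        using dvd[OF m(1)] dvd[OF m(2)] by blast+
      moreover have "torsion m x1 = torsion m y1" "torsion m (x1 * x3) = torsion m (y1 * y3)"
        using xy(3) e by simp_all
      ultimately have "x1 = y1" "x1 * x3 = y1 * y3"
        using card_torsion[OF _ assms] by metis+
      then show "x = y" using m assms e by (auto simp: mult_ac)
    qed
    have "?g x \<in> sections (integer_mod_group m)" if "x \<in> ?X" for x
    proof -
      have "torsion m x1 \<subseteq> torsion m (x1 * x3)" for x1 x3 by (rule torsion_mono) simp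
      then show ?thesis using subgroup_torsion[OF assms] by (cases x) (simp add: sections_def)
    qed
    moreover have "s \<in> ?g ` ?X" if s: "s \<in> sections (integer_mod_group m)" for s
    proof -
      obtain G H where e: "s = (G, H)" by fastforce
      have GH: "subgroup G (integer_mod_group m)" "subgroup H (integer_mod_group m)" "H \<subseteq> G"
        using s e by (auto simp: sections_def)
      have "card H dvd card G"
        using card_FactGroup[OF group_integer_mod_group GH] by (metis dvd_triv_right)
      moreover have "card G dvd m" using subgroup_eq_torsion[OF GH(1) assms] by simp
      ultimately obtain x3 x2 where x: "card G = card H * x3" "m = card H * x3 * x2" by (metis dvdE)
      have "s = ?g (card H, x2, x3)"
        using subgroup_eq_torsion[OF GH(1) assms] subgroup_eq_torsion[OF GH(2) assms] x e by auto
      moreover have "(card H, x2, x3) \<in> ?X" using x by (simp add: mult_ac)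
      ultimately show ?thesis by blast
    qed
    ultimately show "?g ` ?X = sections (integer_mod_group m)" by blast
  qed
  from sum.reindex_bij_betw[OF this, of f] show ?thesis by (simp add: case_prod_beta)
qed

section \<open>Subgroups of a product of two cyclic groups\<close>

lemma (in group) gexp_subgroup_dvd_iff:
  assumes "subgroup K G"
  shows "gexp (G\<lparr>carrier := K\<rparr>) dvd k \<longleftrightarrow> (\<forall>x\<in>K. x [^] k = \<one>)"
proof -
  interpret K: group "G\<lparr>carrier := K\<rparr>" by (intro subgroup_imp_group assms)
  have "x [^]\<^bsub>G\<lparr>carrier := K\<rparr>\<^esub> k = x [^] k" for x by (rule nat_pow_consistent[symmetric])
  then show ?thesis by (simp add: K.gexp_dvd_iff)
qed

text \<open>The second projection maps \<open>K\<close> onto \<open>G2\<close>, with kernel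
  \<open>H1\<close> times the trivial group.\<close>

lemma card_subgroup_DirProd:
  assumes "group A" "group B" "subgroup K (A \<times>\<times> B)" "goursat A B K = ((G1, H1), (G2, H2))"
  shows "card K = card H1 * card G2"
proof -
  interpret AB: group "A \<times>\<times> B" by (intro DirProd_group assms)
  interpret A: group A by fact
  interpret B: group B by fact
  interpret K: subgroup K "A \<times>\<times> B" by fact
  have g: "G2 = snd ` K" "H1 = {a. (a, \<one>\<^bsub>B\<^esub>) \<in> K}" using assms by (auto simp: goursat_def)
  have G2: "subgroup G2 B"
    using goursat_in_sections[OF assms(1-3)] assms(4) by (auto simp: sections_def)
  have "snd \<in> hom ((A \<times>\<times> B)\<lparr>carrier := K\<rparr>) (B\<lparr>carrier := G2\<rparr>)"
    by (rule homI) (auto simp: g)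
  then interpret s: group_hom "(A \<times>\<times> B)\<lparr>carrier := K\<rparr>" "B\<lparr>carrier := G2\<rparr>" snd
    by (intro group_hom.intro group_hom_axioms.intro AB.subgroup_imp_group B.subgroup_imp_group assms G2)
  have ker: "kernel ((A \<times>\<times> B)\<lparr>carrier := K\<rparr>) (B\<lparr>carrier := G2\<rparr>) snd = H1 \<times> {\<one>\<^bsub>B\<^esub>}"
    by (auto simp: kernel_def g)
  have "order ((A \<times>\<times> B)\<lparr>carrier := K\<rparr> Mod (H1 \<times> {\<one>\<^bsub>B\<^esub>})) = card G2"
    using iso_same_card[OF s.FactGroup_iso] unfolding ker by (simp add: g order_def)
  moreover have "subgroup (H1 \<times> {\<one>\<^bsub>B\<^esub>}) (A \<times>\<times> B)"
    using AB.incl_subgroup[OF assms(3) s.subgroup_kernel] by (simp add: ker)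
  then have "order ((A \<times>\<times> B)\<lparr>carrier := K\<rparr> Mod (H1 \<times> {\<one>\<^bsub>B\<^esub>})) * card (H1 \<times> {\<one>\<^bsub>B\<^esub>}) = card K"
    by (intro card_FactGroup AB.is_group assms) (auto simp: g)
  ultimately show ?thesis by (simp add: card_cartesian_product mult.commute)
qed

lemma carrier_section: "group G \<Longrightarrow> subgroup H G \<Longrightarrow> (carrier G, H) \<in> sections G"
  by (auto simp: sections_def group.subgroup_self dest: subgroup.mem_carrier)

lemma order_Mod:
  assumes "group G" "finite (carrier G)" "subgroup H G"
  shows "order (G Mod H) = order G div card H"
proof -
  have "order (G Mod H) * card H = order G"
    using card_FactGroup[OF assms(1) group.subgroup_self[OF assms(1)] assms(3)] subgroup.subset[OF assms(3)]
    by (simp add: order_def)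
  moreover have "card H > 0"
    using subgroup.one_closed[OF assms(3)] finite_subset[OF subgroup.subset[OF assms(3)] assms(2)]
    by (auto simp: card_gt_0_iff)
  ultimately show ?thesis by (metis nonzero_mult_div_cancel_right less_numeral_extra(3))
qed

text \<open>A power annihilates \<open>K\<close> iff it annihilates both projections of
  \<open>K\<close>.\<close>

lemma gexp_subgroup_DirProd:
  assumes "group A" "group B" "subgroup K (A \<times>\<times> B)" "goursat A B K = ((G1, H1), (G2, H2))"
  shows "gexp ((A \<times>\<times> B)\<lparr>carrier := K\<rparr>) = lcm (gexp (A\<lparr>carrier := G1\<rparr>)) (gexp (B\<lparr>carrier := G2\<rparr>))"
proof -
  interpret AB: group "A \<times>\<times> B" by (intro DirProd_group assms)
  interpret A: group A by fact
  interpret B: group B by fact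
  have g: "G1 = fst ` K" "G2 = snd ` K" using assms by (auto simp: goursat_def)
  have G: "subgroup G1 A" "subgroup G2 B"
    using goursat_in_sections[OF assms(1-3)] assms(4) by (auto simp: sections_def)
  show ?thesis
  proof (rule group.gexp_eqI)
    show "group ((A \<times>\<times> B)\<lparr>carrier := K\<rparr>)" by (intro AB.subgroup_imp_group assms)
    fix k :: nat
    have "(\<forall>x\<in>carrier ((A \<times>\<times> B)\<lparr>carrier := K\<rparr>). x [^]\<^bsub>(A \<times>\<times> B)\<lparr>carrier := K\<rparr>\<^esub> k = \<one>\<^bsub>(A \<times>\<times> B)\<lparr>carrier := K\<rparr>\<^esub>)
      \<longleftrightarrow> (\<forall>x\<in>K. fst x [^]\<^bsub>A\<^esub> k = \<one>\<^bsub>A\<^esub> \<and> snd x [^]\<^bsub>B\<^esub> k = \<one>\<^bsub>B\<^esub>)"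
      unfolding AB.nat_pow_consistent[symmetric] by (simp add: DirProd_nat_pow)
    also have "\<dots> \<longleftrightarrow> (\<forall>x\<in>G1. x [^]\<^bsub>A\<^esub> k = \<one>\<^bsub>A\<^esub>) \<and> (\<forall>x\<in>G2. x [^]\<^bsub>B\<^esub> k = \<one>\<^bsub>B\<^esub>)"
      unfolding g by blast
    finally show "(\<forall>x\<in>carrier ((A \<times>\<times> B)\<lparr>carrier := K\<rparr>). x [^]\<^bsub>(A \<times>\<times> B)\<lparr>carrier := K\<rparr>\<^esub> k = \<one>\<^bsub>(A \<times>\<times> B)\<lparr>carrier := K\<rparr>\<^esub>)
      \<longleftrightarrow> lcm (gexp (A\<lparr>carrier := G1\<rparr>)) (gexp (B\<lparr>carrier := G2\<rparr>)) dvd k"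
      by (simp add: A.gexp_subgroup_dvd_iff[OF G(1)] B.gexp_subgroup_dvd_iff[OF G(2)])
  qed
qed

lemma gexp_Mod_dvd_iff:
  assumes "comm_group G" "subgroup H G"
  shows "gexp (G Mod H) dvd k \<longleftrightarrow> (\<forall>x\<in>carrier G. x [^]\<^bsub>G\<^esub> k \<in> H)"
  using comm_group.gexp_subquotient_dvd_iff[OF assms(1) carrier_section[OF _ assms(2)]] assms(1)
  by (simp add: comm_group_def)

lemma comm_group_DirProd: "comm_group A \<Longrightarrow> comm_group B \<Longrightarrow> comm_group (A \<times>\<times> B)"
  by (intro group.group_comm_groupI DirProd_group)
     (auto simp: comm_group_def comm_monoid.m_comm)

text \<open>All \<open>k\<close>-th powers of pairs lie in \<open>K\<close> iff those of pairs with
  one trivial coordinate do, as the general ones are products of these. So the intersections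
  \<open>H1\<close>, \<open>H2\<close> take the place that the projections have for the exponent of
  \<open>K\<close>.\<close>

lemma gexp_Mod_DirProd:
  assumes "comm_group A" "comm_group B" "subgroup K (A \<times>\<times> B)" "goursat A B K = ((G1, H1), (G2, H2))"
  shows "gexp (A \<times>\<times> B Mod K) = lcm (gexp (A Mod H1)) (gexp (B Mod H2))"
proof -
  interpret A: comm_group A by fact
  interpret B: comm_group B by fact
  interpret AB: comm_group "A \<times>\<times> B" by (intro comm_group_DirProd assms)
  interpret K: subgroup K "A \<times>\<times> B" by fact
  have H: "H1 = {a. (a, \<one>\<^bsub>B\<^esub>) \<in> K}" "H2 = {b. (\<one>\<^bsub>A\<^esub>, b) \<in> K}"
    using assms by (auto simp: goursat_def)
  have sub: "subgroup H1 A" "subgroup H2 B"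
    using goursat_in_sections[OF A.is_group B.is_group assms(3)] assms(4) by (auto simp: sections_def)
  have "gexp (A \<times>\<times> B Mod K) dvd k \<longleftrightarrow> lcm (gexp (A Mod H1)) (gexp (B Mod H2)) dvd k" for k
  proof -
    have "gexp (A \<times>\<times> B Mod K) dvd k \<longleftrightarrow>
        (\<forall>a\<in>carrier A. \<forall>b\<in>carrier B. (a [^]\<^bsub>A\<^esub> k, b [^]\<^bsub>B\<^esub> k) \<in> K)"
      by (simp add: gexp_Mod_dvd_iff[OF AB.comm_group_axioms assms(3)] DirProd_nat_pow)
    also have "\<dots> \<longleftrightarrow> (\<forall>a\<in>carrier A. a [^]\<^bsub>A\<^esub> k \<in> H1) \<and> (\<forall>b\<in>carrier B. b [^]\<^bsub>B\<^esub> k \<in> H2)"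
    proof (intro iffI conjI ballI)
      fix a assume *: "\<forall>a\<in>carrier A. \<forall>b\<in>carrier B. (a [^]\<^bsub>A\<^esub> k, b [^]\<^bsub>B\<^esub> k) \<in> K" "a \<in> carrier A"
      then have "(a [^]\<^bsub>A\<^esub> k, \<one>\<^bsub>B\<^esub> [^]\<^bsub>B\<^esub> k) \<in> K" by blast
      then show "a [^]\<^bsub>A\<^esub> k \<in> H1" by (simp add: H)
    next
      fix b assume *: "\<forall>a\<in>carrier A. \<forall>b\<in>carrier B. (a [^]\<^bsub>A\<^esub> k, b [^]\<^bsub>B\<^esub> k) \<in> K" "b \<in> carrier B"
      then have "(\<one>\<^bsub>A\<^esub> [^]\<^bsub>A\<^esub> k, b [^]\<^bsub>B\<^esub> k) \<in> K" by blast
      then show "b [^]\<^bsub>B\<^esub> k \<in> H2" by (simp add: H)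
    next
      fix a b assume *: "(\<forall>a\<in>carrier A. a [^]\<^bsub>A\<^esub> k \<in> H1) \<and> (\<forall>b\<in>carrier B. b [^]\<^bsub>B\<^esub> k \<in> H2)"
        "a \<in> carrier A" "b \<in> carrier B"
      then have "(a [^]\<^bsub>A\<^esub> k, \<one>\<^bsub>B\<^esub>) \<in> K" "(\<one>\<^bsub>A\<^esub>, b [^]\<^bsub>B\<^esub> k) \<in> K" by (auto simp: H)
      from K.m_closed[OF this] show "(a [^]\<^bsub>A\<^esub> k, b [^]\<^bsub>B\<^esub> k) \<in> K" using *(2,3) by simp
    qed
    also have "\<dots> \<longleftrightarrow> lcm (gexp (A Mod H1)) (gexp (B Mod H2)) dvd k"
      by (simp add: gexp_Mod_dvd_iff[OF A.comm_group_axioms sub(1)] gexp_Mod_dvd_iff[OF B.comm_group_axioms sub(2)])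
    finally show ?thesis .
  qed
  then show ?thesis by (meson dvd_antisym dvd_refl)
qed

text \<open>Subgroups and quotients of cyclic groups are cyclic, so the exponents of
  \<open>G1\<close>, \<open>G2\<close> and of the quotients by \<open>H1\<close>, \<open>H2\<close>
  are their orders. Both types thus depend on the Goursat data through cardinalities alone.\<close>

lemma gtype_subgroup_DirProd:
  assumes "comm_group A" "comm_group B" "finite (carrier A)" "finite (carrier B)"
    and "cyclic_group A" "cyclic_group B"
    and K: "subgroup K (A \<times>\<times> B)" and g: "goursat A B K = ((G1, H1), (G2, H2))"
  shows "gtype ((A \<times>\<times> B)\<lparr>carrier := K\<rparr>) =
      (card H1 * card G2 div lcm (card G1) (card G2), lcm (card G1) (card G2))"
    and "gtype (A \<times>\<times> B Mod K) =
      (order A * order B div (card H1 * card G2) div lcm (order A div card H1) (order B div card H2),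
       lcm (order A div card H1) (order B div card H2))"
proof -
  interpret A: comm_group A by fact
  interpret B: comm_group B by fact
  interpret AB: comm_group "A \<times>\<times> B" by (intro comm_group_DirProd assms)
  have s: "(G1, H1) \<in> sections A" "(G2, H2) \<in> sections B"
    using goursat_in_sections[OF A.is_group B.is_group K] g by auto
  then have sub: "subgroup G1 A" "subgroup G2 B" "subgroup H1 A" "subgroup H2 B"
    by (auto simp: sections_def)
  have "gexp (A\<lparr>carrier := G1\<rparr>) = card G1"
    using group.cyclic_gexp[OF A.subgroup_imp_group A.cyclic_group_subgroup] sub assms by (simp add: order_def)
  moreover have "gexp (B\<lparr>carrier := G2\<rparr>) = card G2"
    using group.cyclic_gexp[OF B.subgroup_imp_group B.cyclic_group_subgroup] sub assms by (simp add: order_def)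
  ultimately show "gtype ((A \<times>\<times> B)\<lparr>carrier := K\<rparr>) =
      (card H1 * card G2 div lcm (card G1) (card G2), lcm (card G1) (card G2))"
    using gexp_subgroup_DirProd[OF A.is_group B.is_group K g] card_subgroup_DirProd[OF A.is_group B.is_group K g]
    by (simp add: gtype_def order_def)
  have "gexp (A Mod H1) = order (A Mod H1)"
    using A.cyclic_group_subquotient[OF assms(5) carrier_section[OF A.is_group sub(3)]]
      A.abelian_FactGroup[OF sub(3)] by (simp add: group.cyclic_gexp comm_group_def)
  moreover have "gexp (B Mod H2) = order (B Mod H2)"
    using B.cyclic_group_subquotient[OF assms(6) carrier_section[OF B.is_group sub(4)]]
      B.abelian_FactGroup[OF sub(4)] by (simp add: group.cyclic_gexp comm_group_def)
  ultimately show "gtype (A \<times>\<times> B Mod K) =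
      (order A * order B div (card H1 * card G2) div lcm (order A div card H1) (order B div card H2),
       lcm (order A div card H1) (order B div card H2))"
    using gexp_Mod_DirProd[OF assms(1,2) K g] card_subgroup_DirProd[OF A.is_group B.is_group K g] sub assms
      A.is_group B.is_group AB.is_group
    by (simp add: gtype_def order_Mod K order_DirProd)
qed

section \<open>Parameters of the subgroups of a product of two residue class groups\<close>

definition quintuples :: "nat \<Rightarrow> nat \<Rightarrow> (nat \<times> nat \<times> nat \<times> nat \<times> nat) set" where
  "quintuples m n = {(x1, x2, x3, x4, x5). x1 * x2 * x3 = m \<and> x3 * x4 * x5 = n}"

lemma finite_triples:
  assumes "(m::nat) > 0"
  shows "finite {(x1, x2, x3). x1 * x2 * x3 = m}"
proof (rule finite_subset)
  show "{(x1, x2, x3). x1 * x2 * x3 = m} \<subseteq> {..m} \<times> {..m} \<times> {..m}"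
    using assms by (auto simp: mult_ac intro!: dvd_imp_le)
qed auto

lemma finite_quintuples:
  assumes "m > 0" "n > 0"
  shows "finite (quintuples m n)"
proof (rule finite_subset)
  show "quintuples m n \<subseteq> {..m} \<times> {..m} \<times> {..m} \<times> {..n} \<times> {..n}"
    using assms by (auto simp: quintuples_def mult_ac intro!: dvd_imp_le)
qed auto

text \<open>The sections of the two factors are indexed by triples \<open>(x1, x2, x3)\<close> and
  \<open>(x4, x5, x3')\<close>, with cyclic subquotients of orders \<open>x3\<close> and
  \<open>x3'\<close>. Only the terms with \<open>x3 = x3'\<close> survive, each with
  \<open>totient x3\<close> isomorphisms.\<close>

lemma sum_goursat_integer_mod_groups:
  fixes w :: "_ \<Rightarrow> nat"
  assumes m: "m > 0" and n: "n > 0"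
  defines "A \<equiv> integer_mod_group m" and "B \<equiv> integer_mod_group n"
  shows "(\<Sum>K | subgroup K (A \<times>\<times> B). w (goursat A B K)) =
    (\<Sum>(x1, x2, x3, x4, x5)\<in>quintuples m n.
       totient x3 * w ((torsion m (x1 * x3), torsion m x1), (torsion n (x4 * x3), torsion n x4)))"
proof -
  let ?X = "\<lambda>m. {(x1, x2, x3). x1 * x2 * x3 = (m::nat)}"
  let ?w = "\<lambda>x1 x3 x4. w ((torsion m (x1 * x3), torsion m x1), (torsion n (x4 * x3), torsion n x4))"
  have isos: "card (isos (A\<lparr>carrier := torsion m (x1 * x3)\<rparr> Mod torsion m x1)
      (B\<lparr>carrier := torsion n (x4 * x3')\<rparr> Mod torsion n x4)) = (if x3 = x3' then totient x3 else 0)"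
    if "(x1, x2, x3) \<in> ?X m" "(x4, x5, x3') \<in> ?X n" for x1 x2 x3 x4 x5 x3'
  proof -
    have *: "group (integer_mod_group m\<lparr>carrier := torsion m (a * c)\<rparr> Mod torsion m a) \<and>
        cyclic_group (integer_mod_group m\<lparr>carrier := torsion m (a * c)\<rparr> Mod torsion m a) \<and>
        order (integer_mod_group m\<lparr>carrier := torsion m (a * c)\<rparr> Mod torsion m a) = c"
      if m: "m > 0" and abc: "a * b * c = m" for m a b c
    proof -
      interpret Z: comm_group "integer_mod_group m" by simp
      have a: "a > 0" using m abc by auto
      have le: "torsion m a \<subseteq> torsion m (a * c)" by (rule torsion_mono) simp
      have s: "(torsion m (a * c), torsion m a) \<in> sections (integer_mod_group m)"
        using subgroup_torsion[OF m] le by (simp add: sections_def)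
      have "a dvd m" using abc by auto
      moreover have "m = a * c * b" using abc by (simp add: mult_ac)
      then have "a * c dvd m" by (rule dvdI)
      ultimately have "order (integer_mod_group m\<lparr>carrier := torsion m (a * c)\<rparr> Mod torsion m a) * a = a * c"
        using card_FactGroup[OF Z.is_group subgroup_torsion[OF m] subgroup_torsion[OF m] le]
          card_torsion[OF _ m] by simp
      then show ?thesis
        using Z.section_quotient(1)[OF s] Z.cyclic_group_subquotient[OF cyclic_integer_mod_group s] a
        by (simp add: comm_group_def)
    qed
    \<comment> \<open>A positive order makes the subquotients finite, as the count of isomorphisms
      requires.\<close>
    have pos: "x3 > 0" "x3' > 0" using that m n by auto
    show ?thesis
      using *[OF m, of x1 x2 x3] *[OF n, of x4 x5 x3'] that pos
      by (subst card_isos_cyclic)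
         (auto simp: A_def B_def simp flip: monoid.order_gt_0_iff_finite[OF group.is_monoid])
  qed
  have "(\<Sum>K | subgroup K (A \<times>\<times> B). w (goursat A B K)) =
    (\<Sum>s\<in>sections A. \<Sum>t\<in>sections B. card (isos (subquotient A s) (subquotient B t)) * w (s, t))"
    unfolding A_def B_def using m n by (intro goursat_sum) (auto simp: finite_integer_mod_group)
  also have "\<dots> = (\<Sum>(x1, x2, x3)\<in>?X m. \<Sum>(x4, x5, x3')\<in>?X n.
      card (isos (A\<lparr>carrier := torsion m (x1 * x3)\<rparr> Mod torsion m x1)
      (B\<lparr>carrier := torsion n (x4 * x3')\<rparr> Mod torsion n x4)) *
      w ((torsion m (x1 * x3), torsion m x1), (torsion n (x4 * x3'), torsion n x4)))"
    unfolding A_def B_def sum_sections_integer_mod_group[OF m] sum_sections_integer_mod_group[OF n]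
    by simp
  also have "\<dots> = (\<Sum>(x1, x2, x3)\<in>?X m. \<Sum>(x4, x5, x3')\<in>?X n. if x3 = x3' then totient x3 * ?w x1 x3 x4 else 0)"
  proof (unfold case_prod_beta, intro sum.cong refl)
    fix x y assume "x \<in> {x. fst x * fst (snd x) * snd (snd x) = m}" "y \<in> {x. fst x * fst (snd x) * snd (snd x) = n}"
    then show "card (isos (A\<lparr>carrier := torsion m (fst x * snd (snd x))\<rparr> Mod torsion m (fst x))
        (B\<lparr>carrier := torsion n (fst y * snd (snd y))\<rparr> Mod torsion n (fst y))) *
        w ((torsion m (fst x * snd (snd x)), torsion m (fst x)), (torsion n (fst y * snd (snd y)), torsion n (fst y))) =
      (if snd (snd x) = snd (snd y) then totient (snd (snd x)) * ?w (fst x) (snd (snd x)) (fst y) else 0)"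
      using isos[of "fst x" "fst (snd x)" "snd (snd x)" "fst y" "fst (snd y)" "snd (snd y)"] by (simp add: case_prod_beta)
  qed
  also have "\<dots> = (\<Sum>((x1, x2, x3), (x4, x5, x3'))\<in>?X m \<times> ?X n. if x3 = x3' then totient x3 * ?w x1 x3 x4 else 0)"
    by (simp add: sum.cartesian_product case_prod_beta)
  also have "\<dots> = (\<Sum>((x1, x2, x3), (x4, x5, x3'))\<in>{((x1, x2, x3), (x4, x5, x3')). x1 * x2 * x3 = m \<and> x4 * x5 * x3' = n \<and> x3 = x3'}.
      totient x3 * ?w x1 x3 x4)"
    using finite_triples[OF m] finite_triples[OF n]
    by (intro sum.mono_neutral_cong_right) (auto split: if_splits)
  also have "\<dots> = (\<Sum>(x1, x2, x3, x4, x5)\<in>quintuples m n. totient x3 * ?w x1 x3 x4)"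
    by (rule sum.reindex_bij_witness[of _ "\<lambda>(x1, x2, x3, x4, x5). ((x1, x2, x3), (x4, x5, x3))"
          "\<lambda>((x1, x2, x3), (x4, x5, x3')). (x1, x2, x3, x4, x5)"])
       (auto simp: quintuples_def mult_ac)
  finally show ?thesis .
qed

text \<open>Since gcd times lcm is the product, the exponent c lcm(a, b) divides the order abc with
  cofactor gcd(a, b). The triple (a, b, c) will be \<open>(x1, x4, x3)\<close> for a subgroup and
  \<open>(x2, x5, x3)\<close> for its quotient.\<close>

lemma gcd_lcm_type:
  fixes a b c :: nat
  assumes "a > 0" "b > 0" "c > 0"
  shows "(a * b * c div lcm (a * c) (b * c), lcm (a * c) (b * c)) = (gcd a b, c * lcm a b)"
proof -
  have l: "lcm (a * c) (b * c) = c * lcm a b"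
    using lcm_mult_left[of c a b] by (simp add: mult.commute)
  have "a * b * c = gcd a b * (c * lcm a b)" using prod_gcd_lcm_nat[of a b] by (simp add: mult_ac)
  moreover have "c * lcm a b \<noteq> 0" using assms by simp
  ultimately have "a * b * c div (c * lcm a b) = gcd a b" by (metis nonzero_mult_div_cancel_right)
  then show ?thesis unfolding l by simp
qed

text \<open>\<open>f\<close> takes both types because each is used: the type of the subgroup to pass
  from \<open>Z\<close> to \<open>K\<close>, that of the quotient to pass from \<open>K\<close> to a
  quotient of \<open>K\<close>.\<close>

lemma sum_gtype_integer_mod_groups:
  fixes f :: "nat \<times> nat \<Rightarrow> nat \<times> nat \<Rightarrow> nat"
  assumes m: "m > 0" and n: "n > 0"
  defines "Z \<equiv> integer_mod_group m \<times>\<times> integer_mod_group n"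
  shows "(\<Sum>K | subgroup K Z. f (gtype (Z\<lparr>carrier := K\<rparr>)) (gtype (Z Mod K))) =
    (\<Sum>(x1, x2, x3, x4, x5)\<in>quintuples m n.
       totient x3 * f (gcd x1 x4, x3 * lcm x1 x4) (gcd x2 x5, x3 * lcm x2 x5))"
proof -
  \<comment> \<open>The two types as functions of the Goursat data, following
    \<open>gtype_subgroup_DirProd\<close>.\<close>
  define w where "w = (\<lambda>((G1::int set, H1::int set), (G2::int set, H2::int set)).
    f (card H1 * card G2 div lcm (card G1) (card G2), lcm (card G1) (card G2))
      (m * n div (card H1 * card G2) div lcm (m div card H1) (n div card H2),
       lcm (m div card H1) (n div card H2)))"
  let ?A = "integer_mod_group m" and ?B = "integer_mod_group n"
  have "(\<Sum>K | subgroup K Z. f (gtype (Z\<lparr>carrier := K\<rparr>)) (gtype (Z Mod K))) =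
      (\<Sum>K | subgroup K (?A \<times>\<times> ?B). w (goursat ?A ?B K))"
    unfolding Z_def
  proof (intro sum.cong refl)
    fix K assume "K \<in> {K. subgroup K (?A \<times>\<times> ?B)}"
    then have K: "subgroup K (?A \<times>\<times> ?B)" by simp
    obtain G1 H1 G2 H2 where g: "goursat ?A ?B K = ((G1, H1), (G2, H2))" by (metis surj_pair)
    note gt = gtype_subgroup_DirProd[OF abelian_integer_mod_group abelian_integer_mod_group
        finite_integer_mod_group[OF m] finite_integer_mod_group[OF n]
        cyclic_integer_mod_group cyclic_integer_mod_group K g]
    show "f (gtype ((?A \<times>\<times> ?B)\<lparr>carrier := K\<rparr>)) (gtype (?A \<times>\<times> ?B Mod K)) = w (goursat ?A ?B K)"
      unfolding gt g by (simp add: w_def order_integer_mod_group m n)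
  qed
  also have "\<dots> = (\<Sum>(x1, x2, x3, x4, x5)\<in>quintuples m n.
       totient x3 * w ((torsion m (x1 * x3), torsion m x1), (torsion n (x4 * x3), torsion n x4)))"
    by (rule sum_goursat_integer_mod_groups[OF m n])
  also have "\<dots> = (\<Sum>(x1, x2, x3, x4, x5)\<in>quintuples m n.
       totient x3 * f (gcd x1 x4, x3 * lcm x1 x4) (gcd x2 x5, x3 * lcm x2 x5))"
  proof (intro sum.cong refl, clarify)
    fix x1 x2 x3 x4 x5 assume "(x1, x2, x3, x4, x5) \<in> quintuples m n"
    then have eq: "m = x1 * x3 * x2" "n = x4 * x3 * x5" by (auto simp: quintuples_def mult_ac)
    then have pos: "x1 > 0" "x2 > 0" "x3 > 0" "x4 > 0" "x5 > 0" using m n by auto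
    have c: "card (torsion m (x1 * x3)) = x1 * x3" "card (torsion m x1) = x1"
      "card (torsion n (x4 * x3)) = x4 * x3" "card (torsion n x4) = x4"
      using card_torsion[OF _ m] card_torsion[OF _ n] eq by simp_all
    have q: "m div x1 = x2 * x3" "n div x4 = x5 * x3"
      unfolding eq using pos by (simp_all add: mult_ac)
    \<comment> \<open>\<open>K\<close> has order \<open>x1 * x4 * x3\<close>, so the quotient has
      order \<open>x2 * x5 * x3\<close>: the same shape with \<open>x2\<close>, \<open>x5\<close> in
      place of \<open>x1\<close>, \<open>x4\<close>.\<close>
    have "m * n = x2 * x5 * x3 * (x1 * (x4 * x3))" unfolding eq by (simp add: mult_ac)
    then have q2: "m * n div (x1 * x4 * x3) = x2 * x5 * x3" using pos by (simp add: mult.assoc)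
    have e: "x1 * (x4 * x3) = x1 * x4 * x3" by simp
    have "w ((torsion m (x1 * x3), torsion m x1), (torsion n (x4 * x3), torsion n x4)) =
        f (gcd x1 x4, x3 * lcm x1 x4) (gcd x2 x5, x3 * lcm x2 x5)"
      by (simp only: w_def prod.case c q e q2 gcd_lcm_type[OF pos(1) pos(4) pos(3)] gcd_lcm_type[OF pos(2) pos(5) pos(3)])
    then show "totient x3 * w ((torsion m (x1 * x3), torsion m x1), (torsion n (x4 * x3), torsion n x4)) =
        totient x3 * f (gcd x1 x4, x3 * lcm x1 x4) (gcd x2 x5, x3 * lcm x2 x5)"
      by simp
  qed
  finally show ?thesis .
qed

section \<open>Subquotients of a product of two cyclic groups\<close>

lemma image_subgroups_iso:
  assumes "group G" "group G'" "f \<in> iso G G'"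
  shows "bij_betw ((`) f) {H. subgroup H G} {H. subgroup H G'}"
proof (rule bij_betw_imageI)
  interpret G: group G by fact
  have f: "f \<in> hom G G'" "f ` carrier G = carrier G'" "inj_on f (carrier G)"
    using assms(3) by (auto simp: iso_iff)
  show "inj_on ((`) f) {H. subgroup H G}"
    using f(3) by (intro inj_on_subset[OF inj_on_image_Pow[OF f(3)]]) (auto dest: subgroup.mem_carrier)
  let ?g = "inv_into (carrier G) f"
  have g: "?g \<in> hom G' G" using G.iso_set_sym[OF assms(3)] by (simp add: iso_iff)
  show "(`) f ` {H. subgroup H G} = {H. subgroup H G'}"
  proof (intro equalityI subsetI)
    fix H assume "H \<in> (`) f ` {H. subgroup H G}"
    then show "H \<in> {H. subgroup H G'}"
      using group_hom.subgroup_img_is_subgroup[of G G' f] assms f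
      by (auto simp: group_hom_def group_hom_axioms_def)
  next
    fix H assume "H \<in> {H. subgroup H G'}"
    then have H: "subgroup H G'" by simp
    then have "subgroup (?g ` H) G"
      using group_hom.subgroup_img_is_subgroup[of G' G ?g] assms g
      by (auto simp: group_hom_def group_hom_axioms_def)
    moreover have "f ` ?g ` H = H"
      using subgroup.subset[OF H] f(2) by (metis image_inv_into_cancel)
    ultimately show "H \<in> (`) f ` {H. subgroup H G}" by blast
  qed
qed

lemma gtype_Mod_iso:
  assumes "comm_group G" "comm_group G'" "f \<in> iso G G'" "subgroup H G"
  shows "gtype (G Mod H) = gtype (G' Mod f ` H)"
proof -
  interpret G: comm_group G by fact
  interpret G': comm_group G' by fact
  have f: "f \<in> hom G G'" "f ` carrier G = carrier G'" "inj_on f (carrier G)"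
    using assms(3) by (auto simp: iso_iff)
  interpret f: group_hom G G' f by unfold_locales (fact f)
  have fH: "subgroup (f ` H) G'" by (rule f.subgroup_img_is_subgroup[OF assms(4)])
  note q = G'.section_quotient[OF carrier_section[OF G'.is_group fH], simplified]
  interpret Q: comm_group "G' Mod f ` H" by (rule q(1))
  let ?p = "\<lambda>x. f ` H #>\<^bsub>G'\<^esub> f x"
  have "?p \<in> hom G (G' Mod f ` H)"
    using hom_compose[OF f(1) q(2)] by (simp add: comp_def)
  then interpret p: group_hom G "G' Mod f ` H" ?p by unfold_locales
  have "?p ` carrier G = carrier (G' Mod f ` H)"
    using q(3) unfolding f(2)[symmetric] image_image .
  then have "G Mod kernel G (G' Mod f ` H) ?p \<cong> G' Mod f ` H"
    by (rule p.FactGroup_iso)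
  moreover have "kernel G (G' Mod f ` H) ?p = H"
  proof -
    have "?p x = f ` H \<longleftrightarrow> x \<in> H" if x: "x \<in> carrier G" for x
    proof -
      have "?p x = f ` H \<longleftrightarrow> f x \<in> f ` H"
        using q(4) f.hom_closed[OF x] by auto
      also have "\<dots> \<longleftrightarrow> x \<in> H"
        using f(3) x subgroup.subset[OF assms(4)] by (rule inj_on_image_mem_iff)
      finally show ?thesis .
    qed
    then show ?thesis
      using subgroup.subset[OF assms(4)] by (auto simp: kernel_def)
  qed
  ultimately have "G Mod H \<cong> G' Mod f ` H" by simp
  then show ?thesis
    by (rule gtype_iso[OF comm_group.axioms(2)[OF G.abelian_FactGroup[OF assms(4)]] Q.is_group])
qed

text \<open>\<open>G\<close> is isomorphic to Z_a x Z_b, and an isomorphism carries subgroups to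
  subgroups while preserving the types of the quotients.\<close>

lemma sum_gtype_Mod:
  fixes f :: "nat \<times> nat \<Rightarrow> nat"
  assumes "two_generated G" "comm_group G" "finite (carrier G)" "gtype G = (a, b)"
  shows "(\<Sum>H | subgroup H G. f (gtype (G Mod H))) =
    (\<Sum>(y1, y2, y3, y4, y5)\<in>quintuples a b. totient y3 * f (gcd y2 y5, y3 * lcm y2 y5))"
proof -
  let ?Z = "integer_mod_group a \<times>\<times> integer_mod_group b"
  note ab = two_generated_gtype[OF assms]
  have "a > 0" using ab(1,2) by (auto intro: Nat.gr0I)
  obtain g where g: "g \<in> iso G ?Z" using ab(3) by (auto simp: is_iso_def)
  have Z: "comm_group ?Z" by (intro comm_group_DirProd abelian_integer_mod_group)
  have "(\<Sum>H | subgroup H G. f (gtype (G Mod H))) = (\<Sum>H | subgroup H G. f (gtype (?Z Mod g ` H)))"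
    using gtype_Mod_iso[OF assms(2) Z g] by (intro sum.cong refl) auto
  also have "\<dots> = (\<Sum>H | subgroup H ?Z. f (gtype (?Z Mod H)))"
    using image_subgroups_iso[OF _ _ g] assms(2) Z
    by (intro sum.reindex_bij_betw) (simp add: comm_group_def)
  also have "\<dots> = (\<Sum>(y1, y2, y3, y4, y5)\<in>quintuples a b. totient y3 * f (gcd y2 y5, y3 * lcm y2 y5))"
    by (rule sum_gtype_integer_mod_groups[OF \<open>a > 0\<close> ab(2), where f = "\<lambda>_. f"])
  finally show ?thesis .
qed

text \<open>Being generated by two elements passes to subgroups and then to their images, which
  makes the structure theorem available for subquotients.\<close>

lemma subquotient_two_generated:
  assumes "two_generated G" "comm_group G" "finite (carrier G)" "s \<in> sections G"
  shows "two_generated (subquotient G s)" "comm_group (subquotient G s)" "finite (carrier (subquotient G s))"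
proof -
  interpret G: comm_group G by fact
  obtain K H where s: "s = (K, H)" by fastforce
  have K: "subgroup K G" using assms(4) by (simp add: s sections_def)
  note q = G.section_quotient[OF assms(4)[unfolded s]]
  show "comm_group (subquotient G s)" using q(1) by (simp add: s)
  have "finite K" using subgroup.subset[OF K] assms(3) by (rule finite_subset)
  then show "finite (carrier (subquotient G s))" using q(3) by (simp add: s flip: q(3))
  show "two_generated (subquotient G s)"
    using two_generated_image[OF two_generated_subgroup[OF assms(1,2) K] G.subgroup_imp_group[OF K] _ q(2)] q(1,3)
    by (simp add: s comm_group_def)
qed

text \<open>A section is a subgroup \<open>K\<close> of \<open>Z\<close> followed by a subgroup of
  \<open>K\<close>. The inner sum depends only on the type of \<open>K\<close>, which is
  \<open>(gcd x1 x4, x3 * lcm x1 x4)\<close>; this is why the second quintuple satisfies equations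
  in the first.\<close>

lemma sum_sections_gtype:
  fixes f :: "nat \<times> nat \<Rightarrow> nat"
  assumes m: "m > 0" and n: "n > 0"
  defines "Z \<equiv> integer_mod_group m \<times>\<times> integer_mod_group n"
  shows "(\<Sum>s\<in>sections Z. f (gtype (subquotient Z s))) =
    (\<Sum>(x1, x2, x3, x4, x5)\<in>quintuples m n.
      \<Sum>(y1, y2, y3, y4, y5)\<in>quintuples (gcd x1 x4) (x3 * lcm x1 x4).
        totient x3 * totient y3 * f (gcd y2 y5, y3 * lcm y2 y5))"
proof -
  interpret Z: comm_group Z unfolding Z_def by (intro comm_group_DirProd abelian_integer_mod_group)
  have fin: "finite (carrier Z)" by (simp add: Z_def finite_integer_mod_group m n)
  have two: "two_generated Z"
    unfolding Z_def by (intro two_generated_DirProd cyclic_integer_mod_group) auto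
  \<comment> \<open>The inner sum as a function of the type \<open>(a, b)\<close> of the middle
    group.\<close>
  define F where "F = (\<lambda>(a, b). \<Sum>(y1, y2, y3, y4, y5)\<in>quintuples a b. totient y3 * f (gcd y2 y5, y3 * lcm y2 y5))"
  have sec: "sections Z = Sigma {K. subgroup K Z} (\<lambda>K. {H. subgroup H (Z\<lparr>carrier := K\<rparr>)})"
  proof (intro equalityI subrelI)
    fix K H assume "(K, H) \<in> sections Z"
    then show "(K, H) \<in> Sigma {K. subgroup K Z} (\<lambda>K. {H. subgroup H (Z\<lparr>carrier := K\<rparr>)})"
      using Z.subgroup_incl[of H K] by (auto simp: sections_def)
  next
    fix K H assume "(K, H) \<in> Sigma {K. subgroup K Z} (\<lambda>K. {H. subgroup H (Z\<lparr>carrier := K\<rparr>)})"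
    then have "subgroup K Z" "subgroup H (Z\<lparr>carrier := K\<rparr>)" by auto
    then show "(K, H) \<in> sections Z"
      using Z.incl_subgroup[of K H] subgroup.subset[of H "Z\<lparr>carrier := K\<rparr>"] by (auto simp: sections_def)
  qed
  have finK: "finite (carrier (Z\<lparr>carrier := K\<rparr>))" if "subgroup K Z" for K
    using finite_subset[OF subgroup.subset[OF that] fin] by simp
  have "(\<Sum>s\<in>sections Z. f (gtype (subquotient Z s))) =
    (\<Sum>K | subgroup K Z. \<Sum>H | subgroup H (Z\<lparr>carrier := K\<rparr>). f (gtype (Z\<lparr>carrier := K\<rparr> Mod H)))"
    unfolding sec by (subst sum.Sigma) (auto intro!: finite_subgroups fin finK sum.cong)
  also have "\<dots> = (\<Sum>K | subgroup K Z. F (gtype (Z\<lparr>carrier := K\<rparr>)))"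
  proof (intro sum.cong refl)
    fix K assume "K \<in> {K. subgroup K Z}"
    then have K: "subgroup K Z" by simp
    obtain a b where ab: "gtype (Z\<lparr>carrier := K\<rparr>) = (a, b)" by fastforce
    show "(\<Sum>H | subgroup H (Z\<lparr>carrier := K\<rparr>). f (gtype (Z\<lparr>carrier := K\<rparr> Mod H))) = F (gtype (Z\<lparr>carrier := K\<rparr>))"
      using sum_gtype_Mod[OF two_generated_subgroup[OF two Z.comm_group_axioms K] Z.comm_group_subgroup[OF K] finK[OF K] ab]
      by (simp add: F_def ab)
  qed
  also have "\<dots> = (\<Sum>(x1, x2, x3, x4, x5)\<in>quintuples m n. totient x3 * F (gcd x1 x4, x3 * lcm x1 x4))"
    unfolding Z_def by (rule sum_gtype_integer_mod_groups[OF m n, where f = "\<lambda>t _. F t"])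
  also have "\<dots> = (\<Sum>(x1, x2, x3, x4, x5)\<in>quintuples m n.
      \<Sum>(y1, y2, y3, y4, y5)\<in>quintuples (gcd x1 x4) (x3 * lcm x1 x4).
        totient x3 * totient y3 * f (gcd y2 y5, y3 * lcm y2 y5))"
    by (intro sum.cong refl) (auto simp: F_def sum_distrib_left mult.assoc intro!: sum.cong)
  finally show ?thesis .
qed

section \<open>Flattening the parameters and assembling the formula\<close>

definition decuples where
  "decuples m n = {(x1, x2, x3, x4, x5, y1, y2, y3, y4, y5).
     (x1, x2, x3, x4, x5) \<in> quintuples m n \<and>
     (y1, y2, y3, y4, y5) \<in> quintuples (gcd x1 x4) (x3 * lcm x1 x4)}"

lemma gcd_lcm_quintuple_pos:
  assumes "m > 0" "n > 0" "(x1, x2, x3, x4, x5) \<in> quintuples m n"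
  shows "x1 > 0" "x2 > 0" "x3 > 0" "x4 > 0" "x5 > 0" "gcd x1 x4 > 0" "x3 * lcm x1 x4 > 0"
  using assms by (auto simp: quintuples_def lcm_pos_nat)

lemma sum_decuples:
  fixes f :: "_ \<Rightarrow> nat"
  assumes m: "m > 0" and n: "n > 0"
  shows "(\<Sum>(x1, x2, x3, x4, x5)\<in>quintuples m n.
      \<Sum>(y1, y2, y3, y4, y5)\<in>quintuples (gcd x1 x4) (x3 * lcm x1 x4). f (x1, x2, x3, x4, x5, y1, y2, y3, y4, y5)) =
    sum f (decuples m n)" and "finite (decuples m n)"
proof -
  define S where "S = Sigma (quintuples m n) (\<lambda>(x1, x2, x3, x4, x5). quintuples (gcd x1 x4) (x3 * lcm x1 x4))"
  define h :: "(nat \<times> nat \<times> nat \<times> nat \<times> nat) \<times> (nat \<times> nat \<times> nat \<times> nat \<times> nat) \<Rightarrow> _"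
    where "h = (\<lambda>((x1, x2, x3, x4, x5), (y1, y2, y3, y4, y5)). (x1, x2, x3, x4, x5, y1, y2, y3, y4, y5))"
  have fin: "finite (quintuples m n)" by (rule finite_quintuples[OF m n])
  have fin2: "\<forall>x\<in>quintuples m n. finite (case x of (x1, x2, x3, x4, x5) \<Rightarrow> quintuples (gcd x1 x4) (x3 * lcm x1 x4))"
    using gcd_lcm_quintuple_pos(6,7)[OF m n] by (auto intro!: finite_quintuples)
  have bij: "bij_betw h S (decuples m n)"
    by (rule bij_betwI[where g = "\<lambda>(x1, x2, x3, x4, x5, y1, y2, y3, y4, y5). ((x1, x2, x3, x4, x5), (y1, y2, y3, y4, y5))"])
       (auto simp: h_def S_def decuples_def)
  have "finite S" unfolding S_def using fin fin2 by (intro finite_SigmaI) auto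
  then show "finite (decuples m n)" using bij bij_betw_finite by blast
  have "sum f (decuples m n) = (\<Sum>p\<in>S. f (h p))"
    by (rule sum.reindex_bij_betw[OF bij, symmetric])
  also have "\<dots> = (\<Sum>x\<in>quintuples m n.
      \<Sum>y\<in>(case x of (x1, x2, x3, x4, x5) \<Rightarrow> quintuples (gcd x1 x4) (x3 * lcm x1 x4)). f (h (x, y)))"
    unfolding S_def by (subst sum.Sigma[OF fin fin2]) (simp add: case_prod_beta)
  also have "\<dots> = (\<Sum>(x1, x2, x3, x4, x5)\<in>quintuples m n.
      \<Sum>(y1, y2, y3, y4, y5)\<in>quintuples (gcd x1 x4) (x3 * lcm x1 x4). f (x1, x2, x3, x4, x5, y1, y2, y3, y4, y5))"
    by (intro sum.cong refl) (auto simp: h_def intro!: sum.cong)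
  finally show "(\<Sum>(x1, x2, x3, x4, x5)\<in>quintuples m n.
      \<Sum>(y1, y2, y3, y4, y5)\<in>quintuples (gcd x1 x4) (x3 * lcm x1 x4). f (x1, x2, x3, x4, x5, y1, y2, y3, y4, y5)) =
    sum f (decuples m n)" by simp
qed

text \<open>Positive products have positive factors: this first makes the \<open>x\<close> positive,
  hence their gcd and lcm, and then the \<open>y\<close>. So summing over all naturals agrees with
  summing over positive ones.\<close>

lemma mem_decuples:
  assumes "m > 0" "n > 0"
  shows "(x1, x2, x3, x4, x5, y1, y2, y3, y4, y5) \<in> decuples m n \<longleftrightarrow>
    {x1, x2, x3, x4, x5, y1, y2, y3, y4, y5} \<subseteq> {1..} \<and>
    x1 * x2 * x3 = m \<and> x3 * x4 * x5 = n \<and>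
    y1 * y2 * y3 = gcd x1 x4 \<and> y3 * y4 * y5 = x3 * lcm x1 x4"
proof
  assume mem: "(x1, x2, x3, x4, x5, y1, y2, y3, y4, y5) \<in> decuples m n"
  then have x: "(x1, x2, x3, x4, x5) \<in> quintuples m n"
    and y: "(y1, y2, y3, y4, y5) \<in> quintuples (gcd x1 x4) (x3 * lcm x1 x4)"
    by (simp_all add: decuples_def)
  note px = gcd_lcm_quintuple_pos[OF assms x]
  note py = gcd_lcm_quintuple_pos[OF px(6,7) y]
  show "{x1, x2, x3, x4, x5, y1, y2, y3, y4, y5} \<subseteq> {1..} \<and>
    x1 * x2 * x3 = m \<and> x3 * x4 * x5 = n \<and>
    y1 * y2 * y3 = gcd x1 x4 \<and> y3 * y4 * y5 = x3 * lcm x1 x4"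
    using x y px(1-5) py(1-5) by (simp add: quintuples_def Suc_le_eq)
qed (simp add: decuples_def quintuples_def)

text \<open>Goursat's lemma with weight 1 for the first two and the last two cyclic factors. All
  subquotients are generated by two elements, so the isomorphisms between them are counted by
  type.\<close>

lemma num_subgroups_eq_sum:
  assumes pos: "m > 0" "n > 0" "r > 0" "s > 0"
  defines "A \<equiv> integer_mod_group m \<times>\<times> integer_mod_group n"
    and "B \<equiv> integer_mod_group r \<times>\<times> integer_mod_group s"
  shows "num_subgroups m n r s =
    (\<Sum>p\<in>sections A. \<Sum>q\<in>sections B. if gtype (subquotient A p) = gtype (subquotient B q)
       then num_automorphisms (fst (gtype (subquotient A p))) (snd (gtype (subquotient A p))) else 0)"
proof -
  let ?Z = integer_mod_group
  have A: "two_generated A" "comm_group A" "finite (carrier A)"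
    unfolding A_def using pos
    by (auto intro!: two_generated_DirProd cyclic_integer_mod_group comm_group_DirProd simp: finite_integer_mod_group)
  have B: "two_generated B" "comm_group B" "finite (carrier B)"
    unfolding B_def using pos
    by (auto intro!: two_generated_DirProd cyclic_integer_mod_group comm_group_DirProd simp: finite_integer_mod_group)
  \<comment> \<open>The fourfold product associates to the right and is rebracketed into two
    pairs.\<close>
  have "(\<lambda>(a, b, c, d). ((a, b), (c, d))) \<in> iso (?Z m \<times>\<times> ?Z n \<times>\<times> ?Z r \<times>\<times> ?Z s) (A \<times>\<times> B)"
    unfolding iso_iff
    by (auto simp: A_def B_def hom_def inj_on_def image_iff)
  then have "bij_betw ((`) (\<lambda>(a, b, c, d). ((a, b), (c, d))))
      {H. subgroup H (?Z m \<times>\<times> ?Z n \<times>\<times> ?Z r \<times>\<times> ?Z s)} {H. subgroup H (A \<times>\<times> B)}"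
    using A B by (intro image_subgroups_iso DirProd_group) (auto simp: comm_group_def)
  then have "num_subgroups m n r s = card {H. subgroup H (A \<times>\<times> B)}"
    unfolding num_subgroups_def by (rule bij_betw_same_card)
  also have "\<dots> = (\<Sum>p\<in>sections A. \<Sum>q\<in>sections B. card (isos (subquotient A p) (subquotient B q)))"
    using goursat_sum[OF A(2) B(2) A(3) B(3), where w = "\<lambda>_. 1"] by simp
  finally show ?thesis
    using card_isos_two_generated[OF subquotient_two_generated[OF A] subquotient_two_generated[OF B]]
    by simp
qed

theorem theorem5:
  fixes m n r s :: nat
  assumes "m \<ge> 1" and "n \<ge> 1" and "r \<ge> 1" and "s \<ge> 1"
  shows "num_subgroups m n r s =
    (\<Sum>(x1, x2, x3, x4, x5, y1, y2, y3, y4, y5, z1, z2, z3, z4, z5, t1, t2, t3, t4, t5) \<in>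
        {(x1, x2, x3, x4, x5, y1, y2, y3, y4, y5, z1, z2, z3, z4, z5, t1, t2, t3, t4, t5).
          {x1, x2, x3, x4, x5, y1, y2, y3, y4, y5,
           z1, z2, z3, z4, z5, t1, t2, t3, t4, t5} \<subseteq> {1..} \<and>
          x1 * x2 * x3 = m \<and>
          x3 * x4 * x5 = n \<and>
          y1 * y2 * y3 = gcd x1 x4 \<and>
          y3 * y4 * y5 = x3 * lcm x1 x4 \<and>
          z1 * z2 * z3 = r \<and>
          z3 * z4 * z5 = s \<and>
          t1 * t2 * t3 = gcd z1 z4 \<and>
          t3 * t4 * t5 = z3 * lcm z1 z4 \<and>
          gcd y2 y5 = gcd t2 t5 \<and>
          y3 * lcm y2 y5 = t3 * lcm t2 t5}.
      totient x3 * totient y3 * totient z3 * totient t3 *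
      num_automorphisms (gcd y2 y5) (y3 * lcm y2 y5))"
proof -
  have m: "m > 0" and n: "n > 0" and r: "r > 0" and s: "s > 0" using assms by simp_all
  let ?A = "integer_mod_group m \<times>\<times> integer_mod_group n" and ?B = "integer_mod_group r \<times>\<times> integer_mod_group s"
  \<comment> \<open>The summand depends on the two types only, so the sums over sections can be
    replaced one at a time.\<close>
  define c where "c = (\<lambda>p q. if p = q then num_automorphisms (fst p) (snd p) else 0)"
  define w :: "nat \<times> nat \<times> nat \<times> nat \<times> nat \<times> nat \<times> nat \<times> nat \<times> nat \<times> nat \<Rightarrow> nat"
    where "w = (\<lambda>(x1, x2, x3, x4, x5, y1, y2, y3, y4, y5). totient x3 * totient y3)"
  define ty :: "nat \<times> nat \<times> nat \<times> nat \<times> nat \<times> nat \<times> nat \<times> nat \<times> nat \<times> nat \<Rightarrow> nat \<times> nat"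
    where "ty = (\<lambda>(x1, x2, x3, x4, x5, y1, y2, y3, y4, y5). (gcd y2 y5, y3 * lcm y2 y5))"
  have sec: "(\<Sum>p\<in>sections (integer_mod_group m \<times>\<times> integer_mod_group n). f (gtype (subquotient (integer_mod_group m \<times>\<times> integer_mod_group n) p))) =
      (\<Sum>X\<in>decuples m n. w X * f (ty X))" if "m > 0" "n > 0" for m n f
    unfolding sum_sections_gtype[OF that] sum_decuples(1)[OF that, symmetric]
    by (simp add: w_def ty_def)
  have "num_subgroups m n r s =
    (\<Sum>p\<in>sections ?A. \<Sum>q\<in>sections ?B. c (gtype (subquotient ?A p)) (gtype (subquotient ?B q)))"
    unfolding num_subgroups_eq_sum[OF m n r s] c_def by simp
  \<comment> \<open>First the inner sum is rewritten with the type of the first subquotient fixed;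
    next the outer one, with the new inner sum as a function of that type.\<close>
  also have "\<dots> = (\<Sum>p\<in>sections ?A. \<Sum>Y\<in>decuples r s. w Y * c (gtype (subquotient ?A p)) (ty Y))"
    by (intro sum.cong refl sec[OF r s])
  also have "\<dots> = (\<Sum>X\<in>decuples m n. w X * (\<Sum>Y\<in>decuples r s. w Y * c (ty X) (ty Y)))"
    by (rule sec[OF m n, where f = "\<lambda>u. \<Sum>Y\<in>decuples r s. w Y * c u (ty Y)"])
  also have "\<dots> = (\<Sum>(X, Y)\<in>decuples m n \<times> decuples r s. w X * w Y * c (ty X) (ty Y))"
    by (simp add: sum_distrib_left sum.cartesian_product mult.assoc)
  \<comment> \<open>Terms with different types vanish. Equality of the types amounts to the two
    conditions that define u and v.\<close>
  also have "\<dots> = (\<Sum>(X, Y)\<in>{(X, Y) \<in> decuples m n \<times> decuples r s. ty X = ty Y}.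
      w X * w Y * num_automorphisms (fst (ty X)) (snd (ty X)))"
    using sum_decuples(2)[OF m n] sum_decuples(2)[OF r s]
    by (intro sum.mono_neutral_cong_right) (auto simp: c_def split: if_splits)
  also have "\<dots> = (\<Sum>(x1, x2, x3, x4, x5, y1, y2, y3, y4, y5, z1, z2, z3, z4, z5, t1, t2, t3, t4, t5) \<in>
        {(x1, x2, x3, x4, x5, y1, y2, y3, y4, y5, z1, z2, z3, z4, z5, t1, t2, t3, t4, t5).
          {x1, x2, x3, x4, x5, y1, y2, y3, y4, y5,
           z1, z2, z3, z4, z5, t1, t2, t3, t4, t5} \<subseteq> {1..} \<and>
          x1 * x2 * x3 = m \<and>
          x3 * x4 * x5 = n \<and>
          y1 * y2 * y3 = gcd x1 x4 \<and>
          y3 * y4 * y5 = x3 * lcm x1 x4 \<and>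
          z1 * z2 * z3 = r \<and>
          z3 * z4 * z5 = s \<and>
          t1 * t2 * t3 = gcd z1 z4 \<and>
          t3 * t4 * t5 = z3 * lcm z1 z4 \<and>
          gcd y2 y5 = gcd t2 t5 \<and>
          y3 * lcm y2 y5 = t3 * lcm t2 t5}.
      totient x3 * totient y3 * totient z3 * totient t3 *
      num_automorphisms (gcd y2 y5) (y3 * lcm y2 y5))"
    \<comment> \<open>The twenty components are only rebracketed; \<open>mem_decuples\<close>
      supplies their positivity.\<close>
    by (rule sum.reindex_bij_witness[of _
        "\<lambda>(x1, x2, x3, x4, x5, y1, y2, y3, y4, y5, z1, z2, z3, z4, z5, t1, t2, t3, t4, t5).
          ((x1, x2, x3, x4, x5, y1, y2, y3, y4, y5), (z1, z2, z3, z4, z5, t1, t2, t3, t4, t5))"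
        "\<lambda>((x1, x2, x3, x4, x5, y1, y2, y3, y4, y5), (z1, z2, z3, z4, z5, t1, t2, t3, t4, t5)).
          (x1, x2, x3, x4, x5, y1, y2, y3, y4, y5, z1, z2, z3, z4, z5, t1, t2, t3, t4, t5)"])
      (simp_all add: w_def ty_def mem_decuples[OF m n] mem_decuples[OF r s] split_paired_all)
  finally show ?thesis .
qed

end
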